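(* Let $r\ge1$ be an integer, $1\le p<\infty$, and $u\in W^{r+1,p}(\Omega)$. Assume the mesh $\mathcal{T}_h$ is of tensor-product type: each $K\in\mathcal{T}_h$ is a box with edges parallel to the coordinate axes and with mesh sizes $h_{K,1},\dots,h_{K,n}$ in the respective directions. Let $V_h=\{v: v|_K\in\mathcal{P}_{\rm used}\ \forall K\in\mathcal{T}_h\}$, where $\mathrm{Ind}_{r-1}\subseteq\mathrm{Ind}_{\rm used}$ and $\mathrm{Ind}_r\not\subseteq\mathrm{Ind}_{\rm used}$. Then for every multi-index $\alpha$ with $|\alpha|\le r+1$ there is a constant $C>0$, independent of $u$ and of the mesh sizes, such that $$\inf_{v_h\in V_h}\|D^{\alpha}(u-v_h)\|_{0,p,\Omega,h}\le C\Big(\sum_{K\in\mathcal{T}_h}\sum_{\gamma\in \mathrm{Ind}_{r,\rm rest}}h_K^{p(\gamma-\alpha)}\|D^{\gamma}u\|_{0,p,K}^p+\sum_{K\in\mathcal{T}_h}\sum_{|\gamma|=r+1}h_K^{p(\gamma-\alpha)}\|D^{\gamma}u\|_{0,p,K}^p\Big)^{1/p},$$ where $h_K^{p(\gamma-\alpha)}=h_{K,1}^{p(\gamma_1-\alpha_1)}\cdots h_{K,n}^{p(\gamma_n-\alpha_n)}$.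
   Context: $\Omega\subset\mathbb{R}^n$ ($n\ge1$) is a bounded polytopic domain with Lipschitz boundary and $\mathcal{T}_h$ is a face-to-face partition of $\Omega$ into elements $K$ with $\bar\Omega=\bigcup_{K\in\mathcal{T}_h}K$. A multi-index $\alpha=(\alpha_1,\dots,\alpha_n)$ is an $n$-tuple of non-negative integers with $|\alpha|=\sum_i\alpha_i$, and $D^\alpha$ is the corresponding partial derivative. $\mathrm{Ind}_k=\{\alpha:|\alpha|\le k\}$; $\mathrm{Ind}_{\rm used}$ is a finite set of multi-indices; $\mathrm{Ind}_{r,\rm rest}=\mathrm{Ind}_r\setminus\mathrm{Ind}_{\rm used}$; $\mathcal{P}_{\rm used}=\{\sum_{\alpha\in\mathrm{Ind}_{\rm used}}C_\alpha x^\alpha\}$ (real coefficients). $W^{k,p}(\Omega)$ is the usual Sobolev space; $\|\cdot\|_{0,p,K}$ is the $L^p(K)$ norm. The norm $\|D^\alpha(u-v_h)\|_{0,p,\Omega,h}$ is the broken one: $\big(\sum_{K\in\mathcal{T}_h}\int_K|D^\alpha(u-v_h)|^p\,dK\big)^{1/p}$, with derivatives taken elementwise. *)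

theory Defs
  imports "HOL-Analysis.Analysis"
begin

definition mi_abs :: "('n::finite \<Rightarrow> nat) \<Rightarrow> nat" where
  "mi_abs \<alpha> = (\<Sum>i\<in>UNIV. \<alpha> i)"

definition Ind :: "nat \<Rightarrow> ('n::finite \<Rightarrow> nat) set" where
  "Ind k = {\<alpha>. mi_abs \<alpha> \<le> k}"

definition partial_deriv :: "'n::finite \<Rightarrow> (real^'n \<Rightarrow> real) \<Rightarrow> real^'n \<Rightarrow> real" where
  "partial_deriv i f x = deriv (\<lambda>t. f (x + t *\<^sub>R axis i 1)) 0"

(* Only applied to smooth functions below, for which the order of differentiation
   (i.e. the choice of the list l) is irrelevant. *)
definition multi_partial :: "('n::finite \<Rightarrow> nat) \<Rightarrow> (real^'n \<Rightarrow> real) \<Rightarrow> real^'n \<Rightarrow> real" where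
  "multi_partial \<alpha> f = foldr partial_deriv (SOME l. \<forall>i. count_list l i = \<alpha> i) f"

(* C^infinity: every iterated partial derivative is everywhere (Frechet) differentiable. *)
definition smooth :: "(real^'n::finite \<Rightarrow> real) \<Rightarrow> bool" where
  "smooth f \<longleftrightarrow> (\<forall>l. foldr partial_deriv l f differentiable_on UNIV)"

definition test_functions :: "(real^'n::finite) set \<Rightarrow> (real^'n \<Rightarrow> real) set" where
  "test_functions U =
     {\<phi>. smooth \<phi> \<and> compact (closure {x. \<phi> x \<noteq> 0}) \<and> closure {x. \<phi> x \<noteq> 0} \<subseteq> U}"

(* Functions live on all of R^n; only their values on U matter. *)

definition Lp_space :: "real \<Rightarrow> (real^'n::finite) set \<Rightarrow> (real^'n \<Rightarrow> real) set" where
  "Lp_space p U = {f. set_borel_measurable lebesgue U f \<and>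
                      set_integrable lebesgue U (\<lambda>x. \<bar>f x\<bar> powr p)}"

definition Lp_norm :: "real \<Rightarrow> (real^'n::finite) set \<Rightarrow> (real^'n \<Rightarrow> real) \<Rightarrow> real" where
  "Lp_norm p U f = (LINT x:U|lebesgue. \<bar>f x\<bar> powr p) powr (1 / p)"

definition locally_integrable :: "(real^'n::finite) set \<Rightarrow> (real^'n \<Rightarrow> real) \<Rightarrow> bool" where
  "locally_integrable U f \<longleftrightarrow> (\<forall>C. compact C \<and> C \<subseteq> U \<longrightarrow> set_integrable lebesgue C f)"

definition has_weak_deriv ::
  "(real^'n::finite) set \<Rightarrow> ('n \<Rightarrow> nat) \<Rightarrow> (real^'n \<Rightarrow> real) \<Rightarrow> (real^'n \<Rightarrow> real) \<Rightarrow> bool" where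
  "has_weak_deriv U \<alpha> u g \<longleftrightarrow>
     locally_integrable U u \<and> locally_integrable U g \<and>
     (\<forall>\<phi>\<in>test_functions U.
        (LINT x:U|lebesgue. u x * multi_partial \<alpha> \<phi> x) =
        (-1) ^ mi_abs \<alpha> * (LINT x:U|lebesgue. g x * \<phi> x))"

(* A representative; for open U it is determined almost everywhere on U whenever the weak
   derivative exists. *)
definition weak_deriv ::
  "(real^'n::finite) set \<Rightarrow> ('n \<Rightarrow> nat) \<Rightarrow> (real^'n \<Rightarrow> real) \<Rightarrow> real^'n \<Rightarrow> real" where
  "weak_deriv U \<alpha> u = (SOME g. has_weak_deriv U \<alpha> u g)"

definition Sobolev :: "nat \<Rightarrow> real \<Rightarrow> (real^'n::finite) set \<Rightarrow> (real^'n \<Rightarrow> real) set" where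
  "Sobolev k p U =
     {u \<in> Lp_space p U. \<forall>\<alpha>\<in>Ind k. \<exists>g\<in>Lp_space p U. has_weak_deriv U \<alpha> u g}"

(* Near every boundary point the set is the strict subgraph, in some direction e, of a
   Lipschitz function of the component orthogonal to e. *)
definition lipschitz_boundary :: "(real^'n::finite) set \<Rightarrow> bool" where
  "lipschitz_boundary \<Omega> \<longleftrightarrow>
     (\<forall>x\<in>frontier \<Omega>. \<exists>e \<rho> L (\<psi> :: real^'n \<Rightarrow> real).
        norm e = 1 \<and> \<rho> > 0 \<and> L-lipschitz_on {z. z \<bullet> e = 0} \<psi> \<and>
        \<Omega> \<inter> ball x \<rho> = {y \<in> ball x \<rho>. y \<bullet> e < \<psi> (y - (y \<bullet> e) *\<^sub>R e)})"

definition bounded_polytopic_lipschitz_domain :: "(real^'n::finite) set \<Rightarrow> bool" where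
  "bounded_polytopic_lipschitz_domain \<Omega> \<longleftrightarrow>
     open \<Omega> \<and> connected \<Omega> \<and> \<Omega> \<noteq> {} \<and> bounded \<Omega> \<and>
     (\<exists>P. finite P \<and> (\<forall>K\<in>P. polytope K) \<and> closure \<Omega> = \<Union>P) \<and>
     lipschitz_boundary \<Omega>"

definition face_to_face_partition :: "(real^'n::finite) set \<Rightarrow> (real^'n) set set \<Rightarrow> bool" where
  "face_to_face_partition \<Omega> T \<longleftrightarrow>
     finite T \<and> \<Union>T = closure \<Omega> \<and>
     (\<forall>K\<in>T. polytope K \<and> interior K \<noteq> {}) \<and>
     (\<forall>K\<in>T. \<forall>K'\<in>T. K \<noteq> K' \<longrightarrow>
        interior K \<inter> interior K' = {} \<and> K \<inter> K' face_of K \<and> K \<inter> K' face_of K')"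

definition tensor_product_mesh :: "(real^'n::finite) set \<Rightarrow> (real^'n) set set \<Rightarrow> bool" where
  "tensor_product_mesh \<Omega> T \<longleftrightarrow>
     face_to_face_partition \<Omega> T \<and> (\<forall>K\<in>T. \<exists>a b. K = cbox a b)"

definition mesh_size :: "(real^'n::finite) set \<Rightarrow> 'n \<Rightarrow> real" where
  "mesh_size K i = interval_upperbound K $ i - interval_lowerbound K $ i"

(* h_K^{p (\<gamma> - \<alpha>)}; the exponents may be negative. *)
definition mesh_weight :: "real \<Rightarrow> (real^'n::finite) set \<Rightarrow> ('n \<Rightarrow> nat) \<Rightarrow> ('n \<Rightarrow> nat) \<Rightarrow> real" where
  "mesh_weight p K \<gamma> \<alpha> =
     (\<Prod>i\<in>UNIV. mesh_size K i powr (p * (real (\<gamma> i) - real (\<alpha> i))))"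

definition poly_space :: "('n::finite \<Rightarrow> nat) set \<Rightarrow> (real^'n \<Rightarrow> real) set" where
  "poly_space I = {q. \<exists>c. \<forall>x. q x = (\<Sum>\<alpha>\<in>I. c \<alpha> * (\<Prod>i\<in>UNIV. x $ i ^ \<alpha> i))}"

(* No continuity across element boundaries is required: v|_K is prescribed only on the
   interior of K, since closed neighbouring elements share boundary points, at which
   v would otherwise have to take both polynomial values. *)
definition Vh :: "(real^'n::finite) set set \<Rightarrow> ('n \<Rightarrow> nat) set \<Rightarrow> (real^'n \<Rightarrow> real) set" where
  "Vh T I = {v. \<forall>K\<in>T. \<exists>q\<in>poly_space I. \<forall>x\<in>interior K. v x = q x}"

definition broken_norm ::
  "(real^'n::finite) set set \<Rightarrow> real \<Rightarrow> ('n \<Rightarrow> nat) \<Rightarrow> (real^'n \<Rightarrow> real) \<Rightarrow> real" where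
  "broken_norm T p \<alpha> w =
     (\<Sum>K\<in>T. LINT x:K|lebesgue. \<bar>weak_deriv (interior K) \<alpha> w x\<bar> powr p) powr (1 / p)"

end

theory Submission
  imports Defs "HOL-Probability.Probability_Measure" "HOL-Computational_Algebra.Polynomial"
begin

text \<open>
The estimate is local. On each box \<open>K\<close> a polynomial \<open>q\<close> is chosen, and the bound for \<open>D\<^sup>\<alpha> (u - q)\<close> on \<open>K\<close> is
summed over the mesh; \<open>V\<^sub>h\<close> imposes no continuity, so the local choices need not match.

Let \<open>J\<close> be the set of used multi-indices of order at most \<open>r\<close>, and \<open>\<Gamma>\<close> the set of the other multi-indices of order
at most \<open>r + 1\<close>: the unused ones of order \<open>r\<close>, and all those of order \<open>r + 1\<close>. These are the indices on the right
of the estimate. The polynomial \<open>q\<close>, spanned by the monomials in \<open>J\<close>, is determined by the conditions that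
\<open>D\<^sup>\<beta> (u - q)\<close> has mean zero on \<open>K\<close> for all \<open>\<beta> \<in> J\<close>, a triangular linear system
(\<open>polynomial_with_moments\<close>). For \<open>\<gamma> \<in> \<Gamma>\<close> one has \<open>D\<^sup>\<gamma> q = 0\<close>, since no monomial in \<open>J\<close> is divisible by the one with
exponent \<open>\<gamma>\<close>. For \<open>\<alpha> \<in> J\<close> the Poincare inequality on the box gives
\<open>\<parallel>D\<^sup>\<alpha> (u - q)\<parallel>\<^sup>p \<le> C (\<Sum>i. h\<^sub>i\<^sup>p \<parallel>D\<^bsup>\<alpha> + e\<^sub>i\<^esup> (u - q)\<parallel>\<^sup>p)\<close>, and iterating it until \<open>\<Gamma>\<close> is reached yields precisely the
weights \<open>h\<^bsup>p (\<gamma> - \<alpha>)\<^esup>\<close> (\<open>element_estimate\<close>).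

What makes the constant independent of the shape of the boxes is an anisotropic Poincare inequality
(\<open>poincare_box\<close>). It is obtained directly for weakly differentiable functions, without approximation by
smooth ones: for fixed \<open>z\<close> and almost every \<open>x\<close> with \<open>x\<close> and \<open>x + z\<close> in the box,
\<open>w (x + z) - w x = \<integral> z \<bullet> grad w (x + s z) ds\<close> over \<open>0 \<le> s \<le> 1\<close> (\<open>weak_gradient_difference\<close>), because the two
sides agree against all test functions. Jensen's inequality and an average over \<open>x\<close> and \<open>z\<close> do the rest.

Three facts about weak derivatives support this: their uniqueness, from the fundamental lemma of the
calculus of variations (\<open>fundamental_lemma_of_variations\<close>); the compatibility of the orders \<open>\<alpha>\<close> and
\<open>\<alpha> + e\<^sub>i\<close>, which rests on the symmetry of mixed partial derivatives (\<open>has_weak_deriv_step\<close>); and that classical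
derivatives of smooth functions are weak ones (\<open>has_weak_deriv_smooth\<close>). Finally, elements cover the closure of
the domain, and the Lipschitz boundary guarantees that their interiors lie in the domain itself.
\<close>

section \<open>Calculus of smooth functions\<close>

lemma partial_deriv_eqI:
  assumes "(f has_derivative D) (at x)"
  shows "partial_deriv i f x = D (axis i 1)"
proof -
  have "((\<lambda>t. x + t *\<^sub>R axis i 1) has_derivative (\<lambda>t. t *\<^sub>R axis i (1::real))) (at (0::real))"
    by (auto intro!: derivative_eq_intros)
  from has_derivative_compose[OF this, of f D] assms
  have "((\<lambda>t. f (x + t *\<^sub>R axis i 1)) has_derivative (\<lambda>t. D (t *\<^sub>R axis i 1))) (at 0)"
    by simp
  moreover have "(\<lambda>t. D (t *\<^sub>R axis i 1)) = (*) (D (axis i 1))"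
    using linear_scale[OF has_derivative_linear[OF assms]] by (simp add: mult.commute fun_eq_iff)
  ultimately show ?thesis
    unfolding partial_deriv_def by (intro DERIV_imp_deriv) (simp add: has_field_derivative_def)
qed

lemma vec_sum_axis: "v = (\<Sum>i\<in>UNIV. (v $ i) *\<^sub>R axis i (1::real))"
  by (simp add: vec_eq_iff axis_def if_distrib[of "\<lambda>x. _ * x"] cong: if_cong)

lemma has_derivative_partial_deriv:
  assumes "f differentiable (at x)"
  shows "(f has_derivative (\<lambda>v. \<Sum>i\<in>UNIV. v $ i * partial_deriv i f x)) (at x)"
proof -
  obtain D where D: "(f has_derivative D) (at x)" using assms by (auto simp: differentiable_def)
  have l: "linear D" using D has_derivative_linear by blast
  have "D v = (\<Sum>i\<in>UNIV. v $ i * partial_deriv i f x)" for v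
  proof -
    have "D v = D (\<Sum>i\<in>UNIV. (v $ i) *\<^sub>R axis i 1)" using vec_sum_axis[of v] by simp
    also have "\<dots> = (\<Sum>i\<in>UNIV. v $ i * partial_deriv i f x)"
      by (simp add: linear_sum[OF l] linear_scale[OF l] partial_deriv_eqI[OF D])
    finally show ?thesis .
  qed
  then have "D = (\<lambda>v. \<Sum>i\<in>UNIV. v $ i * partial_deriv i f x)" by auto
  with D show ?thesis by simp
qed

lemma DERIV_along_line:
  assumes "f differentiable (at (x + t *\<^sub>R z))"
  shows "((\<lambda>t. f (x + t *\<^sub>R z)) has_real_derivative
          (\<Sum>i\<in>UNIV. z $ i * partial_deriv i f (x + t *\<^sub>R z))) (at t)"
proof -
  have "((\<lambda>t. x + t *\<^sub>R z) has_derivative (\<lambda>t. t *\<^sub>R z)) (at t)"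
    by (auto intro!: derivative_eq_intros)
  from has_derivative_compose[OF this has_derivative_partial_deriv[OF assms]]
  have "((\<lambda>t. f (x + t *\<^sub>R z)) has_derivative
      (\<lambda>v. \<Sum>i\<in>UNIV. (v *\<^sub>R z) $ i * partial_deriv i f (x + t *\<^sub>R z))) (at t)" .
  moreover have "(\<lambda>v. \<Sum>i\<in>UNIV. (v *\<^sub>R z) $ i * partial_deriv i f (x + t *\<^sub>R z))
      = (*) (\<Sum>i\<in>UNIV. z $ i * partial_deriv i f (x + t *\<^sub>R z))"
    by (simp add: fun_eq_iff sum_distrib_left mult_ac)
  ultimately show ?thesis by (simp add: has_field_derivative_def)
qed

lemma smooth_imp_differentiable: "smooth f \<Longrightarrow> f differentiable (at x)"
  unfolding smooth_def by (drule spec[of _ "[]"]) (simp add: differentiable_on_eq_differentiable_at)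

lemma smooth_imp_continuous_on: "smooth f \<Longrightarrow> continuous_on A f"
  by (meson continuous_at_imp_continuous_on differentiable_imp_continuous_within smooth_imp_differentiable)

lemma smooth_partial_deriv: "smooth f \<Longrightarrow> smooth (partial_deriv i f)"
  unfolding smooth_def
proof
  fix l assume "\<forall>l. foldr partial_deriv l f differentiable_on UNIV"
  then have "foldr partial_deriv (l @ [i]) f differentiable_on UNIV" by blast
  then show "foldr partial_deriv l (partial_deriv i f) differentiable_on UNIV" by simp
qed

lemma smooth_foldr_partial_deriv: "smooth f \<Longrightarrow> smooth (foldr partial_deriv l f)"
  by (induction l) (auto intro: smooth_partial_deriv)

text \<open>Smoothness is a greatest fixed point: it suffices to exhibit a family of differentiable functions
that is stable under partial differentiation.\<close>

lemma smooth_coinduct: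
  assumes "f \<in> F"
    and diff: "\<And>f x. f \<in> F \<Longrightarrow> f differentiable (at x)"
    and part: "\<And>f i. f \<in> F \<Longrightarrow> partial_deriv i f \<in> F"
  shows "smooth f"
proof -
  have "foldr partial_deriv l f \<in> F" for l
    by (induction l) (auto simp: assms)
  then show ?thesis
    unfolding smooth_def by (auto simp: differentiable_on_eq_differentiable_at diff)
qed

text \<open>The Leibniz rule turns one product into a sum of two, so the products of smooth functions are not
a family to which coinduction applies. Closing under sums and products at once repairs this.\<close>

inductive_set smooth_algebra :: "(real^'n::finite \<Rightarrow> real) set" where
  base: "smooth f \<Longrightarrow> f \<in> smooth_algebra"
| add: "f \<in> smooth_algebra \<Longrightarrow> g \<in> smooth_algebra \<Longrightarrow> (\<lambda>x. f x + g x) \<in> smooth_algebra"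
| mult: "f \<in> smooth_algebra \<Longrightarrow> g \<in> smooth_algebra \<Longrightarrow> (\<lambda>x. f x * g x) \<in> smooth_algebra"

lemma partial_deriv_add:
  assumes "f differentiable (at x)" "g differentiable (at x)"
  shows "partial_deriv i (\<lambda>x. f x + g x) x = partial_deriv i f x + partial_deriv i g x"
  using has_derivative_add[OF assms[THEN has_derivative_partial_deriv]]
  by (subst partial_deriv_eqI, assumption)
     (simp add: axis_def if_distrib[of "\<lambda>x. x * _"] cong: if_cong)

lemma partial_deriv_mult:
  assumes "f differentiable (at x)" "g differentiable (at x)"
  shows "partial_deriv i (\<lambda>x. f x * g x) x = f x * partial_deriv i g x + partial_deriv i f x * g x"
  using has_derivative_mult[OF assms[THEN has_derivative_partial_deriv]]
  by (subst partial_deriv_eqI, assumption)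
     (simp add: axis_def if_distrib[of "\<lambda>x. x * _"] cong: if_cong)

lemma smooth_algebra_closed:
  assumes "f \<in> smooth_algebra"
  shows "f differentiable (at x) \<and> partial_deriv i f \<in> smooth_algebra"
  using assms
proof (induction arbitrary: x)
  case (base f)
  then show ?case
    by (auto intro: smooth_algebra.base smooth_partial_deriv smooth_imp_differentiable)
next
  case (add f g)
  then have "partial_deriv i (\<lambda>x. f x + g x) = (\<lambda>x. partial_deriv i f x + partial_deriv i g x)"
    by (intro ext partial_deriv_add) auto
  then show ?case using add by (auto intro: smooth_algebra.add)
next
  case (mult f g)
  then have "partial_deriv i (\<lambda>x. f x * g x)
      = (\<lambda>x. f x * partial_deriv i g x + partial_deriv i f x * g x)"
    by (intro ext partial_deriv_mult) auto
  then show ?case using mult by (auto intro!: smooth_algebra.add smooth_algebra.mult)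
qed

lemma smooth_algebra_eq: "f \<in> smooth_algebra \<Longrightarrow> smooth f"
  by (rule smooth_coinduct[of f smooth_algebra]) (auto dest: smooth_algebra_closed)

lemma smooth_add: "smooth f \<Longrightarrow> smooth g \<Longrightarrow> smooth (\<lambda>x. f x + g x)"
  and smooth_mult: "smooth f \<Longrightarrow> smooth g \<Longrightarrow> smooth (\<lambda>x. f x * g x)"
  by (auto intro!: smooth_algebra_eq intro: smooth_algebra.intros)

lemma partial_deriv_const: "partial_deriv i (\<lambda>_. c) = (\<lambda>_. 0)"
  by (rule ext) (subst partial_deriv_eqI[OF has_derivative_const], simp)

lemma smooth_const: "smooth (\<lambda>_. c)"
  by (rule smooth_coinduct[of _ "range (\<lambda>c _. c)"]) (auto simp: partial_deriv_const)

lemma smooth_sum: "(\<And>i. i \<in> A \<Longrightarrow> smooth (f i)) \<Longrightarrow> smooth (\<lambda>x. \<Sum>i\<in>A. f i x)"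
  by (induction A rule: infinite_finite_induct) (auto intro: smooth_add smooth_const)

lemma smooth_prod: "(\<And>i. i \<in> A \<Longrightarrow> smooth (f i)) \<Longrightarrow> smooth (\<lambda>x. \<Prod>i\<in>A. f i x)"
  by (induction A rule: infinite_finite_induct) (auto intro: smooth_mult smooth_const)

lemma smooth_power: "smooth f \<Longrightarrow> smooth (\<lambda>x. f x ^ k)"
  by (induction k) (auto intro: smooth_mult smooth_const)

lemma has_derivative_nth: "((\<lambda>x. x $ i) has_derivative (\<lambda>v. v $ i)) (at x)"
  by (simp add: bounded_linear_imp_has_derivative bounded_linear_vec_nth)

lemma partial_deriv_nth: "partial_deriv j (\<lambda>x. x $ i) = (\<lambda>_. if i = j then 1 else 0)"
  by (rule ext, subst partial_deriv_eqI[OF has_derivative_nth]) (simp add: axis_def)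

lemma smooth_nth: "smooth (\<lambda>x. x $ i)"
  by (rule smooth_coinduct[of _ "insert (\<lambda>x. x $ i) (range (\<lambda>c _. c))"])
     (auto simp: partial_deriv_const partial_deriv_nth
           intro: differentiableI has_derivative_nth)

lemma smooth_scale: "smooth f \<Longrightarrow> smooth (\<lambda>x. c * f x)"
  by (intro smooth_mult smooth_const)

lemma partial_deriv_translate:
  "partial_deriv i (\<lambda>x. f (x + v)) = (\<lambda>x. partial_deriv i f (x + v))"
  by (simp add: partial_deriv_def fun_eq_iff add_ac)

lemma smooth_translate:
  assumes "smooth f"
  shows "smooth (\<lambda>x. f (x + v))"
proof (rule smooth_coinduct[of _ "{\<lambda>x. f (x + v) |f. smooth f}"])
  show "f differentiable (at x)" if f: "f \<in> {\<lambda>x. f (x + v) |f. smooth f}" for f x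
  proof -
    obtain g where g: "f = (\<lambda>x. g (x + v))" "smooth g" using f by auto
    have "(g \<circ> (\<lambda>x. x + v)) differentiable (at x)"
      by (rule differentiable_chain_at) (auto intro: smooth_imp_differentiable g)
    then show ?thesis by (simp add: g o_def)
  qed
qed (use assms in \<open>auto simp: partial_deriv_translate intro: smooth_partial_deriv\<close>)

section \<open>Mixed partial derivatives and multi-indices\<close>

text \<open>The second difference quotient of \<^term>\<open>f\<close> over a square of side \<^term>\<open>t\<close> is a mixed
derivative at some point of that square, by the mean value theorem in one direction and then in
the other. The left-hand side is symmetric in the two directions, which gives Schwarz's theorem.\<close>

lemma partial_deriv_commute_aux:
  fixes f :: "real^'n::finite \<Rightarrow> real"
  assumes f: "smooth f" and t: "0 < t"
  obtains \<xi> \<eta> where "0 < \<xi>" "\<xi> < t" "0 < \<eta>" "\<eta> < t"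
    "f (x + t *\<^sub>R axis i 1 + t *\<^sub>R axis j 1) - f (x + t *\<^sub>R axis i 1) - f (x + t *\<^sub>R axis j 1) + f x
      = t * t * partial_deriv j (partial_deriv i f) (x + \<xi> *\<^sub>R axis i 1 + \<eta> *\<^sub>R axis j 1)"
proof -
  have D: "((\<lambda>s. g (y + s *\<^sub>R axis k 1)) has_real_derivative partial_deriv k g (y + s *\<^sub>R axis k 1)) (at s)"
    if "smooth g" for g y s k
    using DERIV_along_line[of g y s "axis k 1"] smooth_imp_differentiable[OF that]
    by (simp add: axis_def if_distrib[of "\<lambda>x. x * _"] cong: if_cong)
  define A where "A s = f ((x + t *\<^sub>R axis j 1) + s *\<^sub>R axis i 1) - f (x + s *\<^sub>R axis i 1)" for s
  have "\<exists>\<xi>. 0 < \<xi> \<and> \<xi> < t \<and> A t - A 0 = (t - 0) *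
     (partial_deriv i f ((x + t *\<^sub>R axis j 1) + \<xi> *\<^sub>R axis i 1) - partial_deriv i f (x + \<xi> *\<^sub>R axis i 1))"
    unfolding A_def by (rule MVT2[OF t]) (intro derivative_intros D f)
  then obtain \<xi> where \<xi>: "0 < \<xi>" "\<xi> < t" "A t - A 0 = t *
     (partial_deriv i f ((x + t *\<^sub>R axis j 1) + \<xi> *\<^sub>R axis i 1) - partial_deriv i f (x + \<xi> *\<^sub>R axis i 1))"
    by auto
  have "\<exists>\<eta>. 0 < \<eta> \<and> \<eta> < t \<and>
     partial_deriv i f ((x + \<xi> *\<^sub>R axis i 1) + t *\<^sub>R axis j 1)
     - partial_deriv i f ((x + \<xi> *\<^sub>R axis i 1) + 0 *\<^sub>R axis j 1)
     = (t - 0) * partial_deriv j (partial_deriv i f) ((x + \<xi> *\<^sub>R axis i 1) + \<eta> *\<^sub>R axis j 1)"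
    by (rule MVT2[OF t]) (intro D smooth_partial_deriv f)
  then obtain \<eta> where \<eta>: "0 < \<eta>" "\<eta> < t"
    "partial_deriv i f ((x + \<xi> *\<^sub>R axis i 1) + t *\<^sub>R axis j 1) - partial_deriv i f (x + \<xi> *\<^sub>R axis i 1)
     = t * partial_deriv j (partial_deriv i f) ((x + \<xi> *\<^sub>R axis i 1) + \<eta> *\<^sub>R axis j 1)"
    by auto
  show ?thesis
    by (rule that[of \<xi> \<eta>]) (use \<xi> \<eta> in \<open>auto simp: A_def algebra_simps\<close>)
qed

lemma partial_deriv_commute:
  fixes f :: "real^'n::finite \<Rightarrow> real"
  assumes f: "smooth f"
  shows "partial_deriv i (partial_deriv j f) = partial_deriv j (partial_deriv i f)"
proof (rule ext, rule ccontr)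
  fix x
  let ?a = "partial_deriv i (partial_deriv j f)" and ?b = "partial_deriv j (partial_deriv i f)"
  define e where "e = dist (?a x) (?b x) / 2"
  assume "?a x \<noteq> ?b x"
  then have e: "e > 0" by (simp add: e_def)
  have cont: "isCont ?a x" "isCont ?b x"
    using f by (auto intro!: differentiable_imp_continuous_within smooth_imp_differentiable smooth_partial_deriv)
  obtain d1 where d1: "d1 > 0" "\<And>y. dist y x < d1 \<Longrightarrow> dist (?a y) (?a x) < e"
    using cont(1) e by (auto simp: continuous_at_eps_delta)
  obtain d2 where d2: "d2 > 0" "\<And>y. dist y x < d2 \<Longrightarrow> dist (?b y) (?b x) < e"
    using cont(2) e by (auto simp: continuous_at_eps_delta)
  define t where "t = min d1 d2 / 2"
  have t: "t > 0" using d1 d2 by (simp add: t_def)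
  have near: "dist (x + \<xi> *\<^sub>R axis k 1 + \<eta> *\<^sub>R axis l 1) x < min d1 d2"
    if "0 < \<xi>" "\<xi> < t" "0 < \<eta>" "\<eta> < t" for \<xi> \<eta> k l
  proof -
    have "dist (x + \<xi> *\<^sub>R axis k 1 + \<eta> *\<^sub>R axis l 1) x = norm (\<xi> *\<^sub>R axis k 1 + \<eta> *\<^sub>R axis l (1::real))"
      by (simp add: dist_norm add.assoc)
    also have "\<dots> \<le> norm (\<xi> *\<^sub>R axis k (1::real)) + norm (\<eta> *\<^sub>R axis l (1::real))"
      by (rule norm_triangle_ineq)
    also have "\<dots> = \<xi> + \<eta>" using that by simp
    finally show ?thesis using that by (simp add: t_def)
  qed
  obtain \<xi> \<eta> where 1: "0 < \<xi>" "\<xi> < t" "0 < \<eta>" "\<eta> < t"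
    "f (x + t *\<^sub>R axis i 1 + t *\<^sub>R axis j 1) - f (x + t *\<^sub>R axis i 1) - f (x + t *\<^sub>R axis j 1) + f x
      = t * t * ?b (x + \<xi> *\<^sub>R axis i 1 + \<eta> *\<^sub>R axis j 1)"
    using partial_deriv_commute_aux[OF f t, where i=i and j=j and x=x] by metis
  obtain \<xi>' \<eta>' where 2: "0 < \<xi>'" "\<xi>' < t" "0 < \<eta>'" "\<eta>' < t"
    "f (x + t *\<^sub>R axis j 1 + t *\<^sub>R axis i 1) - f (x + t *\<^sub>R axis j 1) - f (x + t *\<^sub>R axis i 1) + f x
      = t * t * ?a (x + \<xi>' *\<^sub>R axis j 1 + \<eta>' *\<^sub>R axis i 1)"
    using partial_deriv_commute_aux[OF f t, where i=j and j=i and x=x] by metis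
  define y y' where "y = x + \<xi> *\<^sub>R axis i 1 + \<eta> *\<^sub>R axis j 1"
    and "y' = x + \<xi>' *\<^sub>R axis j 1 + \<eta>' *\<^sub>R axis i 1"
  have "t * t * ?b y = t * t * ?a y'"
    using 1(5) 2(5) unfolding y_def y'_def by (simp add: algebra_simps)
  then have "?b y = ?a y'" using t by simp
  moreover have "dist (?b y) (?b x) < e" "dist (?a y') (?a x) < e"
    using near[OF 1(1-4), of i j] near[OF 2(1-4), of j i] d1 d2 by (auto simp: y_def y'_def)
  ultimately have "dist (?a x) (?b x) < e + e"
    by (metis add_strict_mono dist_commute dist_triangle_lt dist_triangle_less_add)
  then show False by (simp add: e_def)
qed

lemma partial_deriv_foldr:
  "smooth f \<Longrightarrow> partial_deriv i (foldr partial_deriv l f) = foldr partial_deriv l (partial_deriv i f)"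
  by (induction l) (simp_all add: partial_deriv_commute smooth_foldr_partial_deriv)

lemma foldr_partial_deriv_mset:
  assumes "smooth f" "mset l = mset l'"
  shows "foldr partial_deriv l f = foldr partial_deriv l' f"
  using assms(2)
proof (induction l arbitrary: l')
  case (Cons i l)
  then have "i \<in> set l'" by (metis list.set_intros(1) mset_eq_setD)
  then obtain l1 l2 where l': "l' = l1 @ i # l2" by (meson split_list)
  with Cons.prems have "mset l = mset (l1 @ l2)" by simp
  from Cons.IH[OF this] show ?case
    using partial_deriv_foldr[OF smooth_foldr_partial_deriv[OF assms(1)], of i l1 l2]
    by (simp add: l')
qed simp

lemma ex_list_count:
  fixes \<alpha> :: "'n::finite \<Rightarrow> nat"
  shows "\<exists>l. \<forall>i. count_list l i = \<alpha> i"
proof -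
  obtain l where "mset l = Abs_multiset \<alpha>" using ex_mset by blast
  then have "count (mset l) i = \<alpha> i" for i by (simp add: Abs_multiset_inverse)
  then show ?thesis by (auto simp: count_mset)
qed

text \<open>The list of directions chosen in the definition of \<^const>\<open>multi_partial\<close> may be replaced by any
other list with the same multiplicities, because mixed partial derivatives of smooth functions commute.\<close>

lemma multi_partial_eq_foldr:
  assumes f: "smooth f" and l: "\<And>i. count_list l i = \<alpha> i"
  shows "multi_partial \<alpha> f = foldr partial_deriv l f"
proof -
  have "\<forall>i. count_list (SOME l. \<forall>i. count_list l i = \<alpha> i) i = \<alpha> i"
    by (rule someI[of _ l]) (simp add: l)
  then have "mset (SOME l. \<forall>i. count_list l i = \<alpha> i) = mset l"
    by (auto intro!: multiset_eqI simp: count_mset l)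
  then show ?thesis unfolding multi_partial_def by (rule foldr_partial_deriv_mset[OF f])
qed

lemma mi_abs_count_list: "(\<And>i. count_list l i = \<alpha> i) \<Longrightarrow> mi_abs \<alpha> = length l"
  by (simp add: mi_abs_def sum_count_set flip: sum_count_set[of l UNIV])

definition mi_unit :: "'n::finite \<Rightarrow> 'n \<Rightarrow> nat" where
  "mi_unit i = (\<lambda>j. if j = i then 1 else 0)"

lemma mi_abs_add_unit: "mi_abs (\<lambda>j. \<alpha> j + mi_unit i j) = Suc (mi_abs \<alpha>)"
  by (simp add: mi_abs_def mi_unit_def sum.distrib)

lemma multi_partial_add_unit:
  assumes "smooth f"
  shows "multi_partial (\<lambda>j. \<alpha> j + mi_unit i j) f = multi_partial \<alpha> (partial_deriv i f)"
proof -
  obtain l where l: "\<And>i. count_list l i = \<alpha> i" using ex_list_count[of \<alpha>] by auto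
  have "multi_partial (\<lambda>j. \<alpha> j + mi_unit i j) f = foldr partial_deriv (l @ [i]) f"
    by (intro multi_partial_eq_foldr assms) (simp add: l mi_unit_def)
  also have "\<dots> = multi_partial \<alpha> (partial_deriv i f)"
    by (simp add: multi_partial_eq_foldr[OF smooth_partial_deriv[OF assms] l])
  finally show ?thesis .
qed

lemma smooth_multi_partial: "smooth f \<Longrightarrow> smooth (multi_partial \<alpha> f)"
  unfolding multi_partial_def by (rule smooth_foldr_partial_deriv)

section \<open>Test functions\<close>

lemma smooth_test: "\<phi> \<in> test_functions U \<Longrightarrow> smooth \<phi>"
  by (simp add: test_functions_def)

lemma test_functions_mono: "U \<subseteq> V \<Longrightarrow> test_functions U \<subseteq> test_functions V"
  by (auto simp: test_functions_def)

lemma zero_outside_support: "x \<notin> closure {x. \<phi> x \<noteq> 0} \<Longrightarrow> \<phi> x = 0"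
  using closure_subset[of "{x. \<phi> x \<noteq> 0}"] by blast

lemma test_function_zero_outside: "\<phi> \<in> test_functions U \<Longrightarrow> x \<notin> U \<Longrightarrow> \<phi> x = 0"
  using zero_outside_support[of x \<phi>] by (auto simp: test_functions_def)

lemma test_functionI:
  assumes "smooth \<phi>" "compact C" "C \<subseteq> U" "\<And>x. x \<notin> C \<Longrightarrow> \<phi> x = 0"
  shows "\<phi> \<in> test_functions U"
proof -
  have "closure {x. \<phi> x \<noteq> 0} \<subseteq> C"
    using assms(4) by (intro closure_minimal compact_imp_closed assms) auto
  moreover have "bounded {x. \<phi> x \<noteq> 0}"
    by (rule bounded_subset[OF compact_imp_bounded[OF assms(2)]]) (use assms(4) in auto)
  ultimately show ?thesis
    using assms by (auto simp: test_functions_def compact_closure)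
qed

lemma test_functionE:
  assumes "\<phi> \<in> test_functions U"
  obtains C where "compact C" "C \<subseteq> U" "\<And>x. x \<notin> C \<Longrightarrow> \<phi> x = 0"
proof (rule that[of "closure {x. \<phi> x \<noteq> 0}"])
  show "\<phi> x = 0" if "x \<notin> closure {x. \<phi> x \<noteq> 0}" for x
    using that by (rule zero_outside_support)
qed (use assms in \<open>auto simp: test_functions_def\<close>)

text \<open>Differentiation does not enlarge the support: this keeps derivatives of test functions among the
test functions.\<close>

lemma partial_deriv_zero_locally:
  assumes "open U" "x \<in> U" "\<And>y. y \<in> U \<Longrightarrow> \<phi> y = 0"
  shows "partial_deriv i \<phi> x = 0"
proof -
  have "(\<phi> has_derivative (\<lambda>_. 0)) (at x)"
    by (rule has_derivative_transform_within_open[OF has_derivative_const[of 0] assms(1,2)])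
       (simp add: assms(3))
  from partial_deriv_eqI[OF this] show ?thesis .
qed

lemma test_function_partial_deriv:
  assumes "\<phi> \<in> test_functions U"
  shows "partial_deriv i \<phi> \<in> test_functions U"
proof -
  obtain C where C: "compact C" "C \<subseteq> U" "\<And>x. x \<notin> C \<Longrightarrow> \<phi> x = 0"
    using test_functionE[OF assms] by blast
  show ?thesis
  proof (rule test_functionI[OF _ C(1,2)])
    show "partial_deriv i \<phi> x = 0" if "x \<notin> C" for x
      by (rule partial_deriv_zero_locally[of "- C"]) (use C that compact_imp_closed in auto)
  qed (use assms in \<open>auto intro: smooth_partial_deriv smooth_test\<close>)
qed

lemma test_function_multi_partial:
  assumes "\<phi> \<in> test_functions U"
  shows "multi_partial \<alpha> \<phi> \<in> test_functions U"
proof -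
  have "foldr partial_deriv l \<phi> \<in> test_functions U" for l
    by (induction l) (auto intro: test_function_partial_deriv assms)
  then show ?thesis by (simp add: multi_partial_def)
qed

lemma test_function_translate:
  assumes "\<phi> \<in> test_functions U" "\<And>x. x \<in> U \<Longrightarrow> x - v \<in> V"
  shows "(\<lambda>x. \<phi> (x + v)) \<in> test_functions V"
proof -
  obtain C where C: "compact C" "C \<subseteq> U" "\<And>x. x \<notin> C \<Longrightarrow> \<phi> x = 0"
    using test_functionE[OF assms(1)] by blast
  show ?thesis
  proof (rule test_functionI)
    show "compact ((\<lambda>x. x - v) ` C)"
      using compact_translation[OF C(1), of "-v"] by (simp add: image_def algebra_simps)
    show "\<phi> (x + v) = 0" if "x \<notin> (\<lambda>x. x - v) ` C" for x
      using that by (intro C(3)) (metis add_diff_cancel_right' imageI)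
  qed (use C assms in \<open>auto intro: smooth_translate smooth_test\<close>)
qed

lemma test_function_mult:
  assumes "smooth q" "\<phi> \<in> test_functions U"
  shows "(\<lambda>x. q x * \<phi> x) \<in> test_functions U"
proof -
  obtain C where C: "compact C" "C \<subseteq> U" "\<And>x. x \<notin> C \<Longrightarrow> \<phi> x = 0"
    using test_functionE[OF assms(2)] by blast
  show ?thesis
    by (rule test_functionI[OF _ C(1,2)]) (use C(3) assms in \<open>auto intro: smooth_mult smooth_test\<close>)
qed

lemma test_function_bounded:
  assumes "\<phi> \<in> test_functions U"
  obtains B where "\<And>x. \<bar>\<phi> x\<bar> \<le> B" "B \<ge> 0"
proof -
  obtain C where C: "compact C" "C \<subseteq> U" "\<And>x. x \<notin> C \<Longrightarrow> \<phi> x = 0"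
    using test_functionE[OF assms] by blast
  have "compact (\<phi> ` C)"
    using assms C(1) by (intro compact_continuous_image smooth_imp_continuous_on smooth_test)
  then obtain B where B: "\<forall>x\<in>C. norm (\<phi> x) \<le> B" "B > 0"
    by (metis bounded_pos compact_imp_bounded imageI)
  show ?thesis
  proof (rule that[of B])
    show "\<bar>\<phi> x\<bar> \<le> B" for x
      by (cases "x \<in> C") (use B C(3)[of x] in auto)
  qed (use B in auto)
qed

lemma borel_measurable_smooth: "smooth f \<Longrightarrow> f \<in> borel_measurable borel"
  by (intro borel_measurable_continuous_onI smooth_imp_continuous_on)

section \<open>Smooth bumps supported in boxes\<close>

text \<open>For the constant polynomial 1 this is the standard flat function \<open>exp (- 1 / t)\<close>, extended by 0.
Its derivatives all have the form \<open>p (1 / t) * exp (- 1 / t)\<close>; carrying the polynomial along makes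
the family stable under differentiation.\<close>

definition flat_exp :: "real poly \<Rightarrow> real \<Rightarrow> real" where
  "flat_exp p t = (if t > 0 then poly p (1 / t) * exp (- 1 / t) else 0)"

lemma flat_exp_tendsto_0: "((\<lambda>t. poly p (1 / t) * exp (- 1 / t)) \<longlongrightarrow> 0) (at_right (0::real))"
proof -
  have "((\<lambda>s. poly p s * exp (- s)) \<longlongrightarrow> 0) (at_top :: real filter)"
  proof (induction p)
    case (pCons a p)
    have *: "((\<lambda>s::real. s ^ k * exp (- s)) \<longlongrightarrow> 0) at_top" for k
      using tendsto_power_div_exp_0[of k] by (simp add: exp_minus divide_inverse)
    have "((\<lambda>s. \<Sum>i\<le>degree q. coeff q i * (s ^ i * exp (- s))) \<longlongrightarrow> (\<Sum>i\<le>degree q. coeff q i * 0)) at_top"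
      for q :: "real poly"
      by (intro tendsto_intros *)
    from this[of "pCons a p"] show ?case
      by (simp add: poly_altdef sum_distrib_right mult.assoc)
  qed simp
  from filterlim_compose[OF this filterlim_inverse_at_top_right]
  show ?thesis by (simp add: divide_inverse)
qed

lemma DERIV_flat_exp:
  "(flat_exp p has_real_derivative flat_exp (pCons 0 (pCons 0 (p - pderiv p))) t) (at t)"
proof -
  consider "t > 0" | "t < 0" | "t = 0" by linarith
  then show ?thesis
  proof cases
    case 1
    have "((\<lambda>t. poly p (1 / t) * exp (- 1 / t)) has_real_derivative
            flat_exp (pCons 0 (pCons 0 (p - pderiv p))) t) (at t)"
      using 1 by (auto intro!: derivative_eq_intros DERIV_chain2[OF poly_DERIV]
             simp: flat_exp_def field_simps power2_eq_square)
    then show ?thesis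
      by (rule has_field_derivative_transform_within_open[of _ _ _ "{0<..}"])
         (use 1 in \<open>auto simp: flat_exp_def\<close>)
  next
    case 2
    have "((\<lambda>_. 0) has_real_derivative flat_exp (pCons 0 (pCons 0 (p - pderiv p))) t) (at t)"
      using 2 by (simp add: flat_exp_def)
    then show ?thesis
      by (rule has_field_derivative_transform_within_open[of _ _ _ "{..<0}"])
         (use 2 in \<open>auto simp: flat_exp_def\<close>)
  next
    case 3
    have "((\<lambda>h. flat_exp p h / h) \<longlongrightarrow> 0) (at 0)"
    proof (rule filterlim_split_at)
      show "((\<lambda>h. flat_exp p h / h) \<longlongrightarrow> 0) (at_left 0)"
        by (rule tendsto_eventually)
           (auto simp: eventually_at_filter flat_exp_def)
      show "((\<lambda>h. flat_exp p h / h) \<longlongrightarrow> 0) (at_right 0)"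
        by (rule Lim_transform_eventually[OF flat_exp_tendsto_0[of "pCons 0 p"]])
           (auto simp: eventually_at_filter flat_exp_def)
    qed
    then show ?thesis using 3 by (simp add: DERIV_def flat_exp_def)
  qed
qed

lemma has_derivative_flat_exp_nth:
  "((\<lambda>x. flat_exp p (c * x $ i + d)) has_derivative
    (\<lambda>v. flat_exp (pCons 0 (pCons 0 (p - pderiv p))) (c * x $ i + d) * (c * v $ i))) (at x)"
proof -
  have "((\<lambda>x. c * x $ i + d) has_derivative (\<lambda>v. c * v $ i)) (at x)"
    by (auto intro!: derivative_eq_intros bounded_linear_imp_has_derivative bounded_linear_vec_nth)
  from has_derivative_compose[OF this DERIV_flat_exp[unfolded has_field_derivative_def]]
  show ?thesis .
qed

lemma smooth_flat_exp_nth: "smooth (\<lambda>x. flat_exp p (c * x $ i + d))"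
proof (rule smooth_coinduct[of _ "range (\<lambda>p x. flat_exp p (c * x $ i + d))"])
  show "partial_deriv j f \<in> range (\<lambda>p x. flat_exp p (c * x $ i + d))"
    if f: "f \<in> range (\<lambda>p x. flat_exp p (c * x $ i + d))" for f j
  proof -
    obtain p where f: "f = (\<lambda>x. flat_exp p (c * x $ i + d))" using f by auto
    have "partial_deriv j f
        = (\<lambda>x. flat_exp (smult (c * axis j 1 $ i) (pCons 0 (pCons 0 (p - pderiv p)))) (c * x $ i + d))"
      unfolding f by (rule ext) (subst partial_deriv_eqI[OF has_derivative_flat_exp_nth], simp add: flat_exp_def)
    then show ?thesis by blast
  qed
qed (auto intro: differentiableI has_derivative_flat_exp_nth)

definition box_bump :: "real^'n::finite \<Rightarrow> real^'n \<Rightarrow> nat \<Rightarrow> real^'n \<Rightarrow> real" where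
  "box_bump a b k x = (\<Prod>i\<in>UNIV. flat_exp 1 (k * (x $ i - a $ i)) * flat_exp 1 (k * (b $ i - x $ i)))"

lemma smooth_box_bump:
  fixes a b :: "real^'n::finite"
  shows "smooth (box_bump a b k)"
proof -
  have "smooth (\<lambda>x::real^'n. \<Prod>i\<in>UNIV. flat_exp 1 (real k * x $ i + (- real k * a $ i))
                 * flat_exp 1 ((- real k) * x $ i + real k * b $ i))"
    by (intro smooth_prod smooth_mult smooth_flat_exp_nth)
  then show ?thesis by (simp add: box_bump_def[abs_def] algebra_simps)
qed

lemma box_bump_eq_0:
  assumes "x \<notin> box a b"
  shows "box_bump a b k x = 0"
proof -
  obtain i where "\<not> (a $ i < x $ i \<and> x $ i < b $ i)" using assms by (auto simp: mem_box_cart)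
  then have "flat_exp 1 (real k * (x $ i - a $ i)) * flat_exp 1 (real k * (b $ i - x $ i)) = 0"
    by (auto simp: flat_exp_def zero_less_mult_iff)
  then show ?thesis unfolding box_bump_def by (intro prod_zero) auto
qed

lemma box_bump_test: "cbox a b \<subseteq> U \<Longrightarrow> box_bump a b k \<in> test_functions U"
  using box_subset_cbox by (intro test_functionI[of _ "cbox a b"] smooth_box_bump box_bump_eq_0) auto

lemma flat_exp_1_bounds: "0 \<le> flat_exp 1 t" "flat_exp 1 t \<le> 1"
  by (auto simp: flat_exp_def)

lemma abs_box_bump_le: "\<bar>box_bump a b k x\<bar> \<le> 1"
  unfolding box_bump_def abs_prod
  by (intro prod_le_1) (auto simp: abs_mult flat_exp_1_bounds intro!: mult_le_one)

lemma flat_exp_1_tendsto: "t > 0 \<Longrightarrow> (\<lambda>k. flat_exp 1 (real k * t)) \<longlonglongrightarrow> 1"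
proof (rule Lim_transform_eventually)
  assume t: "t > 0"
  have "(\<lambda>k. exp (- (1 / t) * (1 / real k))) \<longlonglongrightarrow> exp (- (1 / t) * 0)"
    by (intro tendsto_intros lim_1_over_n)
  then show "(\<lambda>k. exp (- (1 / t) * (1 / real k))) \<longlonglongrightarrow> 1" by simp
  show "\<forall>\<^sub>F k in sequentially. exp (- (1 / t) * (1 / real k)) = flat_exp 1 (real k * t)"
    using eventually_gt_at_top[of 0] by eventually_elim (use t in \<open>auto simp: flat_exp_def field_simps\<close>)
qed

text \<open>Rescaling the flat function makes it converge to the indicator of the positive half-line, so these
bumps increase to the indicator of the box while their supports stay in its closure.\<close>

lemma box_bump_tendsto:
  fixes a b :: "real^'n::finite"
  shows "(\<lambda>k. box_bump a b k x) \<longlonglongrightarrow> indicator (box a b) x"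
proof (cases "x \<in> box a b")
  case True
  then have "(\<lambda>k. box_bump a b k x) \<longlonglongrightarrow> (\<Prod>i\<in>(UNIV::'n set). 1 * 1)"
    unfolding box_bump_def by (intro tendsto_prod tendsto_mult flat_exp_1_tendsto) (auto simp: mem_box_cart)
  with True show ?thesis by simp
next
  case False
  then show ?thesis by (simp add: box_bump_eq_0)
qed

section \<open>The fundamental lemma of the calculus of variations\<close>

text \<open>By Lebesgue differentiation, almost every value of an integrable function is a limit of averages over
shrinking boxes, and at a point of the open set these averages eventually vanish.\<close>

lemma integrable_zero_boxes_AE_zero:
  fixes f :: "real^'n::finite \<Rightarrow> real"
  assumes f: "integrable lebesgue f"
    and zero: "\<And>c d. cbox c d \<subseteq> U \<Longrightarrow> (LINT x:cbox c d|lebesgue. f x) = 0"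
    and U: "open U"
  shows "AE x in lebesgue. x \<in> U \<longrightarrow> f x = 0"
proof -
  have si: "set_integrable lebesgue (cbox a b) f" for a b
    unfolding set_integrable_def using f by (intro integrable_mult_indicator) auto
  then have io: "f integrable_on cbox a b" for a b
    by (rule set_lebesgue_integral_eq_integral(1))
  obtain N where N: "negligible N" and lim:
    "\<And>x e. \<lbrakk>x \<notin> N; 0 < e\<rbrakk> \<Longrightarrow> \<exists>d>0. \<forall>h. 0 < h \<and> h < d \<longrightarrow>
        norm (integral (cbox x (x + h *\<^sub>R One)) f /\<^sub>R h ^ DIM(real^'n) - f x) < e"
    using integrable_ccontinuous_explicit[of f, OF io] by metis
  have "f x = 0" if x: "x \<in> U" "x \<notin> N" for x
  proof (rule ccontr)
    assume "f x \<noteq> 0"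
    then have "norm (f x) > 0" by simp
    from lim[OF x(2) this] obtain d where d: "d > 0" "\<And>h. 0 < h \<Longrightarrow> h < d \<Longrightarrow>
        norm (integral (cbox x (x + h *\<^sub>R One)) f /\<^sub>R h ^ DIM(real^'n) - f x) < norm (f x)"
      by blast
    obtain r where r: "r > 0" "ball x r \<subseteq> U" using U x(1) openE by blast
    define E where "E = norm (One::real^'n) + 1"
    have E: "E > 0" by (simp add: E_def add_nonneg_pos)
    \<comment> \<open>Small enough both for the approximation property and for the box to stay in the ball.\<close>
    define h where "h = min (d / 2) (r / 2 / E)"
    have h: "h > 0" "h < d" using d(1) r(1) E by (auto simp: h_def min_less_iff_disj)
    have "h * E \<le> r / 2 / E * E" using E by (intro mult_right_mono) (auto simp: h_def)
    also have "\<dots> = r / 2" using E by simp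
    finally have hr: "h * norm (One::real^'n) < r"
      using E h(1) r(1) by (simp add: E_def algebra_simps)
    have "cbox x (x + h *\<^sub>R One) \<subseteq> ball x r"
    proof
      fix y assume y: "y \<in> cbox x (x + h *\<^sub>R One)"
      have "norm (y - x) \<le> norm (h *\<^sub>R (One::real^'n))"
      proof (rule norm_le_componentwise)
        fix b :: "real^'n" assume b: "b \<in> Basis"
        have "x \<bullet> b \<le> y \<bullet> b" "y \<bullet> b \<le> (x + h *\<^sub>R One) \<bullet> b"
          using y b unfolding mem_box by auto
        then show "\<bar>(y - x) \<bullet> b\<bar> \<le> \<bar>h *\<^sub>R (One::real^'n) \<bullet> b\<bar>"
          by (simp add: inner_diff_left inner_add_left)
      qed
      also have "\<dots> < r" using hr h by simp
      finally show "y \<in> ball x r" by (simp add: dist_norm norm_minus_commute)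
    qed
    with r have "cbox x (x + h *\<^sub>R One) \<subseteq> U" by blast
    from zero[OF this] have "integral (cbox x (x + h *\<^sub>R One)) f = 0"
      using set_lebesgue_integral_eq_integral(2)[OF si] by simp
    with d(2)[OF h] show False by simp
  qed
  then have "{x \<in> space lebesgue. \<not> (x \<in> U \<longrightarrow> f x = 0)} \<subseteq> N" by auto
  with N show ?thesis
    by (intro AE_I') (auto simp: negligible_iff_null_sets)
qed

text \<open>Bumps converge boundedly to indicators of boxes, so vanishing against all test functions forces all
integrals over boxes inside the open set to vanish. Local integrability permits working on one compact
box at a time; countably many of them exhaust the open set.\<close>

lemma fundamental_lemma_of_variations:
  fixes f :: "real^'n::finite \<Rightarrow> real"
  assumes U: "open U" and f: "locally_integrable U f"
    and zero: "\<And>\<phi>. \<phi> \<in> test_functions U \<Longrightarrow> (LINT x:U|lebesgue. f x * \<phi> x) = 0"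
  shows "AE x in lebesgue. x \<in> U \<longrightarrow> f x = 0"
proof -
  have box0: "(LINT x:cbox a b|lebesgue. f x) = 0" if ab: "cbox a b \<subseteq> U" for a b
  proof -
    have si: "set_integrable lebesgue (cbox a b) f"
      using f ab by (auto simp: locally_integrable_def)
    define F where "F x = indicator (cbox a b) x * f x" for x
    have F: "integrable lebesgue F" using si by (simp add: set_integrable_def F_def[abs_def])
    then have [measurable]: "F \<in> borel_measurable lebesgue" by auto
    have bm [measurable]: "box_bump a b k \<in> borel_measurable lebesgue" for k
      using borel_measurable_smooth[OF smooth_box_bump] by (intro measurable_completion) simp
    have "(\<lambda>k. LINT x|lebesgue. F x * box_bump a b k x) \<longlonglongrightarrow> (LINT x|lebesgue. F x * indicator (box a b) x)"
    proof (rule integral_dominated_convergence[where w = "\<lambda>x. \<bar>F x\<bar>"])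
      show "AE x in lebesgue. (\<lambda>k. F x * box_bump a b k x) \<longlonglongrightarrow> F x * indicator (box a b) x"
        by (intro AE_I2 tendsto_intros box_bump_tendsto)
      show "AE x in lebesgue. norm (F x * box_bump a b k x) \<le> \<bar>F x\<bar>" for k
        by (intro AE_I2) (simp add: abs_mult mult_left_le abs_box_bump_le)
    qed (use F in \<open>auto intro!: borel_measurable_times borel_measurable_indicator\<close>)
    moreover have "(LINT x|lebesgue. F x * box_bump a b k x) = 0" for k
    proof -
      have "(LINT x|lebesgue. F x * box_bump a b k x) = (LINT x:U|lebesgue. f x * box_bump a b k x)"
        unfolding set_lebesgue_integral_def
      proof (rule Bochner_Integration.integral_cong[OF refl])
        fix x show "F x * box_bump a b k x = indicator U x *\<^sub>R (f x * box_bump a b k x)"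
        proof (cases "x \<in> box a b")
          case True
          then have "x \<in> cbox a b" using box_subset_cbox by blast
          with ab have "x \<in> U" by blast
          with \<open>x \<in> cbox a b\<close> show ?thesis by (simp add: F_def)
        qed (simp add: box_bump_eq_0)
      qed
      also have "\<dots> = 0" by (rule zero[OF box_bump_test[OF ab]])
      finally show ?thesis .
    qed
    ultimately have "(LINT x|lebesgue. F x * indicator (box a b) x) = 0"
      by (simp add: LIMSEQ_const_iff)
    moreover have "(LINT x|lebesgue. F x * indicator (box a b) x) = (LINT x:cbox a b|lebesgue. f x)"
      unfolding set_lebesgue_integral_def
    proof (rule integral_cong_AE)
      have "AE x in lebesgue. x \<notin> cbox a b - box a b"
        by (rule AE_not_in) (simp add: negligible_iff_null_sets[symmetric] negligible_frontier_interval)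
      then show "AE x in lebesgue. F x * indicator (box a b) x = indicator (cbox a b) x *\<^sub>R f x"
        by eventually_elim (use box_subset_cbox[of a b] in \<open>auto simp: F_def indicator_def\<close>)
    qed (use si in \<open>auto simp: set_integrable_def intro!: borel_measurable_times borel_measurable_indicator\<close>)
    ultimately show ?thesis by simp
  qed
  obtain \<D> where D: "countable \<D>" "\<D> \<subseteq> Pow U" "\<And>X. X \<in> \<D> \<Longrightarrow> \<exists>a b. X = cbox a b" "\<Union>\<D> = U"
    using open_countable_Union_open_cbox[OF U] by metis
  have "AE x in lebesgue. x \<in> X \<longrightarrow> f x = 0" if X: "X \<in> \<D>" for X
  proof -
    obtain a b where ab: "X = cbox a b" "cbox a b \<subseteq> U" using D(2,3) X by blast
    have si: "set_integrable lebesgue (cbox a b) f"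
      using f ab by (auto simp: locally_integrable_def)
    have "AE x in lebesgue. x \<in> box a b \<longrightarrow> indicator (cbox a b) x * f x = 0"
    proof (rule integrable_zero_boxes_AE_zero)
      show "integrable lebesgue (\<lambda>x. indicator (cbox a b) x * f x)"
        using si by (simp add: set_integrable_def)
      show "(LINT x:cbox c d|lebesgue. indicator (cbox a b) x * f x) = 0" if cd: "cbox c d \<subseteq> box a b" for c d
      proof -
        have "cbox c d \<subseteq> cbox a b" using cd box_subset_cbox by blast
        then have "(LINT x:cbox c d|lebesgue. indicator (cbox a b) x * f x) = (LINT x:cbox c d|lebesgue. f x)"
          unfolding set_lebesgue_integral_def
          by (intro Bochner_Integration.integral_cong) (auto simp: indicator_def)
        with box0[of c d] \<open>cbox c d \<subseteq> cbox a b\<close> ab(2) show ?thesis by auto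
      qed
    qed auto
    moreover have "AE x in lebesgue. x \<notin> cbox a b - box a b"
      by (rule AE_not_in) (simp add: negligible_iff_null_sets[symmetric] negligible_frontier_interval)
    ultimately show ?thesis
      by eventually_elim (use ab in \<open>auto simp: indicator_def\<close>)
  qed
  then have "AE x in lebesgue. \<forall>X\<in>\<D>. x \<in> X \<longrightarrow> f x = 0"
    by (subst AE_ball_countable[OF D(1)]) blast
  then show ?thesis by (rule AE_mp) (use D(4) in \<open>auto intro!: AE_I2\<close>)
qed

section \<open>Translations and integration by parts\<close>

lemma borel_measurable_lebesgue_of_borel: "f \<in> borel_measurable borel \<Longrightarrow> f \<in> borel_measurable lebesgue"
  by (intro measurable_completion) simp

lemma integrable_translate:
  fixes f :: "'a::euclidean_space \<Rightarrow> real"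
  assumes "integrable lborel f"
  shows "integrable lborel (\<lambda>x. f (x + v))"
  using integrable_distr[of "(+) v" lborel borel f] assms
  by (simp add: lborel_distr_plus add.commute)

lemma integral_translate:
  fixes f :: "'a::euclidean_space \<Rightarrow> real"
  assumes "f \<in> borel_measurable borel"
  shows "(\<integral>x. f (x + v) \<partial>lborel) = (\<integral>x. f x \<partial>lborel)"
  using integral_distr[of "(+) v" lborel borel f] assms
  by (simp add: lborel_distr_plus add.commute)

lemma nn_integral_translate:
  fixes f :: "'a::euclidean_space \<Rightarrow> ennreal"
  assumes "f \<in> borel_measurable borel"
  shows "(\<integral>\<^sup>+x. f (x + v) \<partial>lborel) = (\<integral>\<^sup>+x. f x \<partial>lborel)"
  using nn_integral_distr[of "(+) v" lborel borel f] assms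
  by (simp add: lborel_distr_plus add.commute)

text \<open>The form in which Tonelli's theorem justifies every exchange of an integral over space with an integral
over the parameter of a segment: a bound on the spatial integral that is uniform in the parameter.\<close>

lemma integrable_unit_interval_pair:
  fixes h :: "real \<times> 'a::euclidean_space \<Rightarrow> real"
  assumes [measurable]: "h \<in> borel_measurable borel"
    and bound: "\<And>s. (\<integral>\<^sup>+x. norm (h (s, x)) \<partial>lborel) \<le> ennreal K * indicator {0..1} s"
  shows "integrable (lborel \<Otimes>\<^sub>M lborel) h"
proof (rule integrableI_bounded)
  have m: "h \<in> borel_measurable (lborel \<Otimes>\<^sub>M lborel)" by (simp add: lborel_prod)
  then show "h \<in> borel_measurable (lborel \<Otimes>\<^sub>M lborel)" .
  have "(\<integral>\<^sup>+y. norm (h y) \<partial>(lborel \<Otimes>\<^sub>M lborel)) = (\<integral>\<^sup>+s. \<integral>\<^sup>+x. norm (h (s, x)) \<partial>lborel \<partial>lborel)"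
    using m by (subst lborel.nn_integral_fst[symmetric]) auto
  also have "\<dots> \<le> (\<integral>\<^sup>+s. ennreal K * indicator {0..1::real} s \<partial>lborel)"
    by (intro nn_integral_mono bound)
  also have "\<dots> = ennreal K" by (simp add: nn_integral_cmult)
  finally show "(\<integral>\<^sup>+y. norm (h y) \<partial>(lborel \<Otimes>\<^sub>M lborel)) < \<infinity>"
    by (rule le_less_trans) simp
qed

lemma integrable_mult_bounded:
  fixes f g :: "'a \<Rightarrow> real"
  assumes "integrable M f" "g \<in> borel_measurable M" "\<And>x. \<bar>g x\<bar> \<le> B"
  shows "integrable M (\<lambda>x. f x * g x)"
proof (rule Bochner_Integration.integrable_bound[of _ "\<lambda>x. B * \<bar>f x\<bar>"])
  show "AE x in M. norm (f x * g x) \<le> norm (B * \<bar>f x\<bar>)"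
  proof (rule AE_I2)
    fix x
    have "\<bar>f x\<bar> * \<bar>g x\<bar> \<le> \<bar>f x\<bar> * \<bar>B\<bar>"
      using assms(3)[of x] by (intro mult_left_mono) auto
    then show "norm (f x * g x) \<le> norm (B * \<bar>f x\<bar>)" by (simp add: abs_mult mult.commute)
  qed
qed (use assms in auto)

text \<open>The difference of a test function along a segment is the integral of its directional derivative.
Exchanging integrals moves this identity under the pairing with \<^term>\<open>w\<close>. What remains are pairings
with derivatives of translated test functions, which a weak derivative of \<^term>\<open>w\<close> can absorb.\<close>

lemma integral_shift_difference:
  fixes w :: "real^'n::finite \<Rightarrow> real"
  assumes w: "integrable lborel w" and \<psi>: "\<psi> \<in> test_functions UNIV"
  shows "(\<integral>x. w x * (\<psi> (x + z) - \<psi> x) \<partial>lborel)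
       = (\<integral>s. (\<Sum>i\<in>UNIV. z $ i * (\<integral>x. w x * partial_deriv i \<psi> (x + s *\<^sub>R z) \<partial>lborel)) * indicator {0..1} s \<partial>lborel)"
proof -
  have sm: "smooth \<psi>" "smooth (partial_deriv i \<psi>)" for i
    using \<psi> by (auto intro: smooth_test smooth_partial_deriv)
  define d where "d y = (\<Sum>i\<in>UNIV. z $ i * partial_deriv i \<psi> y)" for y
  have dt: "d \<in> test_functions UNIV"
  proof -
    have 1: "smooth d" unfolding d_def by (intro smooth_sum smooth_scale sm)
    obtain C where C: "compact C" "\<And>x. x \<notin> C \<Longrightarrow> \<psi> x = 0"
      using test_functionE[OF \<psi>] by metis
    have "d x = 0" if "x \<notin> C" for x
      unfolding d_def
      using partial_deriv_zero_locally[of "- C" x \<psi>] C that compact_imp_closed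
      by (intro sum.neutral) auto
    with 1 C show ?thesis by (intro test_functionI[of d C]) auto
  qed
  obtain B where B: "\<And>x. \<bar>d x\<bar> \<le> B" "B \<ge> 0" using test_function_bounded[OF dt] by metis
  have [measurable]: "d \<in> borel_measurable borel" by (rule borel_measurable_smooth[OF smooth_test[OF dt]])
  have [measurable]: "w \<in> borel_measurable borel" using w by auto
  have [measurable]: "partial_deriv i \<psi> \<in> borel_measurable borel" for i by (rule borel_measurable_smooth[OF sm(2)])
  have ftc: "\<psi> (x + z) - \<psi> x = (\<integral>s. d (x + s *\<^sub>R z) * indicator {0..1} s \<partial>lborel)" for x
  proof -
    have "(\<integral>s. d (x + s *\<^sub>R z) * indicator {0..1} s \<partial>lborel) = \<psi> (x + 1 *\<^sub>R z) - \<psi> (x + 0 *\<^sub>R z)"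
      unfolding d_def
    proof (rule integral_FTC_Icc_real)
      show "((\<lambda>s. \<psi> (x + s *\<^sub>R z)) has_real_derivative (\<Sum>i\<in>UNIV. z $ i * partial_deriv i \<psi> (x + t *\<^sub>R z))) (at t)" for t
        by (rule DERIV_along_line) (rule smooth_imp_differentiable[OF sm(1)])
      have "isCont (\<lambda>t. d (x + t *\<^sub>R z)) t" for t
      proof (rule isCont_o2[of t "\<lambda>t. x + t *\<^sub>R z" d])
        show "isCont (\<lambda>t. x + t *\<^sub>R z) t" by (intro continuous_intros)
        show "isCont d (x + t *\<^sub>R z)"
          by (rule differentiable_imp_continuous_within[OF smooth_imp_differentiable[OF smooth_test[OF dt]]])
      qed
      then show "isCont (\<lambda>t. \<Sum>i\<in>UNIV. z $ i * partial_deriv i \<psi> (x + t *\<^sub>R z)) t" for t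
        by (simp add: d_def)
    qed simp
    then show ?thesis by simp
  qed
  define h where "h = (\<lambda>(s, x). w x * d (x + s *\<^sub>R z) * indicator {0..1} (s::real))"
  have [measurable]: "h \<in> borel_measurable (lborel \<Otimes>\<^sub>M lborel)"
    unfolding h_def by measurable
  have int: "integrable (lborel \<Otimes>\<^sub>M lborel) h"
  proof (rule integrable_unit_interval_pair)
    show "h \<in> borel_measurable borel" using \<open>h \<in> borel_measurable (lborel \<Otimes>\<^sub>M lborel)\<close> by (simp add: lborel_prod)
    fix s :: real
    have "(\<integral>\<^sup>+x. norm (h (s, x)) \<partial>lborel) \<le> (\<integral>\<^sup>+x. ennreal (B * \<bar>w x\<bar>) * indicator {0..1} s \<partial>lborel)"
    proof (intro nn_integral_mono)
      fix x
      have "\<bar>w x\<bar> * \<bar>d (x + s *\<^sub>R z)\<bar> \<le> \<bar>w x\<bar> * B" using B by (intro mult_left_mono) auto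
      then show "ennreal (norm (h (s, x))) \<le> ennreal (B * \<bar>w x\<bar>) * indicator {0..1} s"
        by (auto simp: h_def indicator_def abs_mult mult.commute intro!: ennreal_leI)
    qed
    also have "\<dots> = (\<integral>\<^sup>+x. ennreal (B * \<bar>w x\<bar>) \<partial>lborel) * indicator {0..1} s"
      by (rule nn_integral_multc) auto
    also have "(\<integral>\<^sup>+x. ennreal (B * \<bar>w x\<bar>) \<partial>lborel) = ennreal (\<integral>x. B * \<bar>w x\<bar> \<partial>lborel)"
      using w B by (intro nn_integral_eq_integral) auto
    finally show "(\<integral>\<^sup>+x. norm (h (s, x)) \<partial>lborel) \<le> ennreal (\<integral>x. B * \<bar>w x\<bar> \<partial>lborel) * indicator {0..1} s" .
  qed
  have "(\<integral>x. w x * (\<psi> (x + z) - \<psi> x) \<partial>lborel) = (\<integral>x. (\<integral>s. h (s, x) \<partial>lborel) \<partial>lborel)"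
    unfolding ftc h_def by (simp add: mult.assoc)
  also have "\<dots> = (\<integral>s. (\<integral>x. h (s, x) \<partial>lborel) \<partial>lborel)"
    using lborel_pair.Fubini_integral[of "\<lambda>s x. h (s, x)"] int by simp
  also have "\<dots> = (\<integral>s. (\<Sum>i\<in>UNIV. z $ i * (\<integral>x. w x * partial_deriv i \<psi> (x + s *\<^sub>R z) \<partial>lborel)) * indicator {0..1} s \<partial>lborel)"
  proof (intro Bochner_Integration.integral_cong refl)
    fix s :: real
    have i: "integrable lborel (\<lambda>x. w x * partial_deriv i \<psi> (x + s *\<^sub>R z))" for i
    proof -
      obtain B where "\<And>x. \<bar>partial_deriv i \<psi> x\<bar> \<le> B"
        using test_function_bounded[OF test_function_partial_deriv[OF \<psi>, of i]] by metis
      then show ?thesis by (intro integrable_mult_bounded[OF w]) auto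
    qed
    have "h (s, x) = (\<Sum>i\<in>UNIV. z $ i * (w x * partial_deriv i \<psi> (x + s *\<^sub>R z))) * indicator {0..1} s" for x
      by (simp add: h_def d_def sum_distrib_left mult.left_commute)
    then have "(\<integral>x. h (s, x) \<partial>lborel) = (\<integral>x. (\<Sum>i\<in>UNIV. z $ i * (w x * partial_deriv i \<psi> (x + s *\<^sub>R z))) \<partial>lborel) * indicator {0..1} s"
      by (simp only: integral_mult_left_zero)
    also have "(\<integral>x. (\<Sum>i\<in>UNIV. z $ i * (w x * partial_deriv i \<psi> (x + s *\<^sub>R z))) \<partial>lborel)
        = (\<Sum>i\<in>UNIV. z $ i * (\<integral>x. w x * partial_deriv i \<psi> (x + s *\<^sub>R z) \<partial>lborel))"
      using i by (subst Bochner_Integration.integral_sum) auto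
    finally show "(\<integral>x. h (s, x) \<partial>lborel) = (\<Sum>i\<in>UNIV. z $ i * (\<integral>x. w x * partial_deriv i \<psi> (x + s *\<^sub>R z) \<partial>lborel)) * indicator {0..1} s" .
  qed
  finally show ?thesis .
qed

lemma integrable_test_function:
  assumes "\<phi> \<in> test_functions U"
  shows "integrable lborel \<phi>"
proof -
  obtain C where C: "compact C" "C \<subseteq> U" "\<And>x. x \<notin> C \<Longrightarrow> \<phi> x = 0"
    using test_functionE[OF assms] by blast
  have "integrable lborel (\<lambda>x. indicator C x *\<^sub>R \<phi> x)"
    by (intro borel_integrable_compact C(1) smooth_imp_continuous_on smooth_test[OF assms])
  moreover have "(\<lambda>x. indicator C x *\<^sub>R \<phi> x) = \<phi>" using C(3) by (auto simp: indicator_def fun_eq_iff)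
  ultimately show ?thesis by simp
qed

text \<open>Translation invariance gives \<open>\<integral> \<psi> (x + e) - \<psi> x = 0\<close>, and the difference is an average of translates of
the partial derivative, all of which have the same integral.\<close>

lemma integral_partial_deriv_test_function:
  fixes \<psi> :: "real^'n::finite \<Rightarrow> real"
  assumes \<psi>: "\<psi> \<in> test_functions U"
  shows "(\<integral>x. partial_deriv i \<psi> x \<partial>lborel) = 0"
proof -
  have \<psi>': "\<psi> \<in> test_functions UNIV" using \<psi> test_functions_mono by blast
  obtain C where C: "compact C" "\<And>x. x \<notin> C \<Longrightarrow> \<psi> x = 0" using test_functionE[OF \<psi>] by metis
  obtain r where r: "\<And>x. x \<in> C \<Longrightarrow> norm x \<le> r"
    using compact_imp_bounded[OF C(1)] unfolding bounded_iff by blast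
  have pd0: "partial_deriv i \<psi> x = 0" if "x \<notin> C" for x
    by (rule partial_deriv_zero_locally[of "- C"]) (use C that compact_imp_closed in auto)
  \<comment> \<open>The constant weight 1 is not integrable, but it may be cut off outside all the supports that occur.\<close>
  define w :: "real^'n \<Rightarrow> real" where "w = indicator (cball 0 (r + 1))"
  have iw: "integrable lborel w"
    unfolding w_def using emeasure_bounded_finite[OF bounded_cball[of "0::real^'n" "r + 1"]]
    by (simp add: integrable_indicator_iff)
  let ?e = "axis i (1::real) :: real^'n"
  have out: "x + s *\<^sub>R ?e \<notin> C" if "x \<notin> cball 0 (r + 1)" "0 \<le> s" "s \<le> 1" for x s
  proof
    assume "x + s *\<^sub>R ?e \<in> C"
    then have "norm (x + s *\<^sub>R ?e) \<le> r" by (rule r)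
    moreover have "norm x \<le> norm (x + s *\<^sub>R ?e) + norm (s *\<^sub>R ?e)"
      by (metis add_diff_cancel_right' norm_triangle_ineq4)
    ultimately show False using that by simp
  qed
  have [measurable]: "\<psi> \<in> borel_measurable borel" "partial_deriv i \<psi> \<in> borel_measurable borel"
    using smooth_test[OF \<psi>] by (auto intro!: borel_measurable_smooth smooth_partial_deriv)
  have w1: "w x * partial_deriv i \<psi> (x + s *\<^sub>R ?e) = partial_deriv i \<psi> (x + s *\<^sub>R ?e)"
    if "0 \<le> s" "s \<le> 1" for s x
    using out[OF _ that, of x] pd0 by (auto simp: w_def indicator_def)
  have w2: "w x * (\<psi> (x + ?e) - \<psi> x) = \<psi> (x + ?e) - \<psi> x" for x
    using out[of x 0] out[of x 1] C(2) by (auto simp: w_def indicator_def)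
  have "0 = (\<integral>x. \<psi> (x + ?e) - \<psi> x \<partial>lborel)"
    using integrable_test_function[OF \<psi>] integral_translate[of \<psi> ?e] integrable_translate[of \<psi> ?e]
    by simp
  also have "\<dots> = (\<integral>x. w x * (\<psi> (x + ?e) - \<psi> x) \<partial>lborel)" by (simp add: w2)
  also have "\<dots> = (\<integral>s. (\<Sum>j\<in>UNIV. ?e $ j * (\<integral>x. w x * partial_deriv j \<psi> (x + s *\<^sub>R ?e) \<partial>lborel)) * indicator {0..1} s \<partial>lborel)"
    by (rule integral_shift_difference[OF iw \<psi>'])
  also have "\<dots> = (\<integral>s. (\<integral>x. w x * partial_deriv i \<psi> (x + s *\<^sub>R ?e) \<partial>lborel) * indicator {0..1} s \<partial>lborel)"
    by (simp add: axis_def if_distrib[of "\<lambda>x. x * _"] cong: if_cong)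
  also have "\<dots> = (\<integral>s. (\<integral>x. partial_deriv i \<psi> x \<partial>lborel) * indicator {0..1::real} s \<partial>lborel)"
  proof (rule Bochner_Integration.integral_cong[OF refl])
    fix s :: real
    show "(\<integral>x. w x * partial_deriv i \<psi> (x + s *\<^sub>R ?e) \<partial>lborel) * indicator {0..1} s
        = (\<integral>x. partial_deriv i \<psi> x \<partial>lborel) * indicator {0..1} s"
      using integral_translate[of "partial_deriv i \<psi>" "s *\<^sub>R ?e"]
      by (cases "s \<in> {0..1}") (simp_all add: w1)
  qed
  also have "\<dots> = (\<integral>x. partial_deriv i \<psi> x \<partial>lborel)" by simp
  finally show ?thesis by simp
qed

section \<open>Weak derivatives\<close>

lemma locally_integrable_subset: "locally_integrable U f \<Longrightarrow> V \<subseteq> U \<Longrightarrow> locally_integrable V f"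
  by (auto simp: locally_integrable_def)

lemma locally_integrable_cong:
  "(\<And>x. x \<in> U \<Longrightarrow> f x = g x) \<Longrightarrow> locally_integrable U f \<longleftrightarrow> locally_integrable U g"
  unfolding locally_integrable_def
  by (intro all_cong1 imp_cong refl set_integrable_cong) auto

lemma locally_integrable_diff:
  "locally_integrable U f \<Longrightarrow> locally_integrable U g \<Longrightarrow> locally_integrable U (\<lambda>x. f x - g x)"
  by (auto simp: locally_integrable_def intro: set_integral_diff)

lemma locally_integrable_continuous:
  assumes "continuous_on UNIV (f :: real^'n::finite \<Rightarrow> real)"
  shows "locally_integrable U f"
  unfolding locally_integrable_def set_integrable_def
proof (intro allI impI)
  fix C assume "compact C \<and> C \<subseteq> U"
  then have "integrable lborel (\<lambda>x. indicator C x *\<^sub>R f x)"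
    using assms by (intro borel_integrable_compact) (auto intro: continuous_on_subset)
  then show "integrable lebesgue (\<lambda>x. indicator C x *\<^sub>R f x)"
    by (subst integrable_completion) auto
qed

lemma set_integrable_mult_test:
  assumes f: "locally_integrable U f" and \<phi>: "\<phi> \<in> test_functions U"
  shows "set_integrable lebesgue U (\<lambda>x. f x * \<phi> x)"
proof -
  obtain C where C: "compact C" "C \<subseteq> U" "\<And>x. x \<notin> C \<Longrightarrow> \<phi> x = 0"
    using test_functionE[OF \<phi>] by blast
  obtain B where B: "\<And>x. \<bar>\<phi> x\<bar> \<le> B" using test_function_bounded[OF \<phi>] by blast
  have "integrable lebesgue (\<lambda>x. (indicator C x *\<^sub>R f x) * \<phi> x)"
    using f C by (intro integrable_mult_bounded[OF _ _ B] borel_measurable_lebesgue_of_borel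
        borel_measurable_smooth smooth_test[OF \<phi>]) (auto simp: locally_integrable_def set_integrable_def)
  moreover have "(\<lambda>x. (indicator C x *\<^sub>R f x) * \<phi> x) = (\<lambda>x. indicator U x *\<^sub>R (f x * \<phi> x))"
    using C by (auto simp: indicator_def fun_eq_iff)
  ultimately show ?thesis by (simp add: set_integrable_def)
qed

lemma set_integral_vanishing:
  assumes "V \<subseteq> U" "\<And>x. x \<notin> V \<Longrightarrow> f x = 0"
  shows "(LINT x:U|M. f x) = (LINT x:V|M. f x :: real)"
  unfolding set_lebesgue_integral_def
  by (intro Bochner_Integration.integral_cong refl) (use assms in \<open>auto simp: indicator_def\<close>)

lemma has_weak_deriv_subset:
  assumes d: "has_weak_deriv U \<alpha> u g" and V: "V \<subseteq> U"
  shows "has_weak_deriv V \<alpha> u g"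
  unfolding has_weak_deriv_def
proof (intro conjI ballI)
  fix \<phi> assume \<phi>: "\<phi> \<in> test_functions V"
  have "(LINT x:U|lebesgue. u x * multi_partial \<alpha> \<phi> x) = (LINT x:V|lebesgue. u x * multi_partial \<alpha> \<phi> x)"
       "(LINT x:U|lebesgue. g x * \<phi> x) = (LINT x:V|lebesgue. g x * \<phi> x)"
    by (rule set_integral_vanishing[OF V];
        simp add: test_function_zero_outside[OF \<phi>]
          test_function_zero_outside[OF test_function_multi_partial[OF \<phi>]])+
  with d \<phi> V test_functions_mono[OF V]
  show "(LINT x:V|lebesgue. u x * multi_partial \<alpha> \<phi> x) = (-1) ^ mi_abs \<alpha> * (LINT x:V|lebesgue. g x * \<phi> x)"
    unfolding has_weak_deriv_def by (metis subsetD)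
qed (use d V in \<open>auto simp: has_weak_deriv_def intro: locally_integrable_subset\<close>)

lemma has_weak_deriv_cong:
  assumes "\<And>x. x \<in> U \<Longrightarrow> u x = u' x"
  shows "has_weak_deriv U \<alpha> u g \<longleftrightarrow> has_weak_deriv U \<alpha> u' g"
proof -
  have "(LINT x:U|lebesgue. u x * \<psi> x) = (LINT x:U|lebesgue. u' x * \<psi> x)" for \<psi>
    unfolding set_lebesgue_integral_def
    by (intro Bochner_Integration.integral_cong refl) (use assms in \<open>auto simp: indicator_def\<close>)
  then show ?thesis
    unfolding has_weak_deriv_def using locally_integrable_cong[of U u u'] assms by simp
qed

lemma has_weak_deriv_diff:
  assumes "has_weak_deriv U \<alpha> u g" "has_weak_deriv U \<alpha> v h"
  shows "has_weak_deriv U \<alpha> (\<lambda>x. u x - v x) (\<lambda>x. g x - h x)"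
  unfolding has_weak_deriv_def
proof (intro conjI ballI)
  fix \<phi> assume \<phi>: "\<phi> \<in> test_functions U"
  have li: "locally_integrable U u" "locally_integrable U v" "locally_integrable U g" "locally_integrable U h"
    using assms by (auto simp: has_weak_deriv_def)
  have "(LINT x:U|lebesgue. (u x - v x) * multi_partial \<alpha> \<phi> x)
      = (LINT x:U|lebesgue. u x * multi_partial \<alpha> \<phi> x) - (LINT x:U|lebesgue. v x * multi_partial \<alpha> \<phi> x)"
    by (simp add: left_diff_distrib set_integral_diff set_integrable_mult_test li test_function_multi_partial \<phi>)
  moreover have "(LINT x:U|lebesgue. (g x - h x) * \<phi> x)
      = (LINT x:U|lebesgue. g x * \<phi> x) - (LINT x:U|lebesgue. h x * \<phi> x)"
    by (simp add: left_diff_distrib set_integral_diff set_integrable_mult_test li \<phi>)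
  ultimately show "(LINT x:U|lebesgue. (u x - v x) * multi_partial \<alpha> \<phi> x) = (-1) ^ mi_abs \<alpha> * (LINT x:U|lebesgue. (g x - h x) * \<phi> x)"
    using assms \<phi> by (simp add: has_weak_deriv_def right_diff_distrib)
qed (use assms in \<open>auto simp: has_weak_deriv_def intro: locally_integrable_diff\<close>)

lemma has_weak_deriv_unique:
  assumes U: "open U" and d: "has_weak_deriv U \<alpha> u g" "has_weak_deriv U \<alpha> u h"
  shows "AE x in lebesgue. x \<in> U \<longrightarrow> g x = h x"
proof -
  have li: "locally_integrable U g" "locally_integrable U h"
    using d by (auto simp: has_weak_deriv_def)
  have "AE x in lebesgue. x \<in> U \<longrightarrow> g x - h x = 0"
  proof (rule fundamental_lemma_of_variations[OF U locally_integrable_diff[OF li]])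
    fix \<phi> assume \<phi>: "\<phi> \<in> test_functions U"
    have "(-1) ^ mi_abs \<alpha> * (LINT x:U|lebesgue. g x * \<phi> x) = (-1) ^ mi_abs \<alpha> * (LINT x:U|lebesgue. h x * \<phi> x)"
      using d \<phi> by (auto simp: has_weak_deriv_def)
    then show "(LINT x:U|lebesgue. (g x - h x) * \<phi> x) = 0"
      by (simp add: left_diff_distrib set_integral_diff set_integrable_mult_test li \<phi>)
  qed
  then show ?thesis by simp
qed

lemma has_weak_deriv_weak_deriv: "has_weak_deriv U \<alpha> u g \<Longrightarrow> has_weak_deriv U \<alpha> u (weak_deriv U \<alpha> u)"
  unfolding weak_deriv_def by (rule someI[of "has_weak_deriv U \<alpha> u"])

text \<open>The weak derivative of order \<open>\<alpha> + e\<^sub>i\<close> is the weak partial derivative of that of order \<open>\<alpha>\<close>: insert the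
derivative \<open>\<partial>\<^sub>i \<phi>\<close> of a test function into the definition of the latter.\<close>

lemma has_weak_deriv_step:
  assumes g: "has_weak_deriv U \<alpha> u g" and f: "has_weak_deriv U (\<lambda>j. \<alpha> j + mi_unit i j) u f"
    and \<phi>: "\<phi> \<in> test_functions U"
  shows "(LINT x:U|lebesgue. g x * partial_deriv i \<phi> x) = - (LINT x:U|lebesgue. f x * \<phi> x)"
proof -
  have "(LINT x:U|lebesgue. u x * multi_partial \<alpha> (partial_deriv i \<phi>) x)
      = (-1) ^ mi_abs \<alpha> * (LINT x:U|lebesgue. g x * partial_deriv i \<phi> x)"
    using g test_function_partial_deriv[OF \<phi>] by (auto simp: has_weak_deriv_def)
  moreover have "(LINT x:U|lebesgue. u x * multi_partial (\<lambda>j. \<alpha> j + mi_unit i j) \<phi> x)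
      = (-1) ^ Suc (mi_abs \<alpha>) * (LINT x:U|lebesgue. f x * \<phi> x)"
    using f \<phi> unfolding has_weak_deriv_def mi_abs_add_unit by blast
  then have "(LINT x:U|lebesgue. u x * multi_partial \<alpha> (partial_deriv i \<phi>) x)
      = (-1) ^ Suc (mi_abs \<alpha>) * (LINT x:U|lebesgue. f x * \<phi> x)"
    by (simp only: multi_partial_add_unit[OF smooth_test[OF \<phi>]])
  ultimately have "(-1) ^ mi_abs \<alpha> * (LINT x:U|lebesgue. g x * partial_deriv i \<phi> x)
      = (-1) ^ mi_abs \<alpha> * (- (LINT x:U|lebesgue. f x * \<phi> x))" by simp
  then have "(-1 :: real) ^ mi_abs \<alpha> = 0 \<or>
      (LINT x:U|lebesgue. g x * partial_deriv i \<phi> x) = - (LINT x:U|lebesgue. f x * \<phi> x)"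
    by (simp only: mult_cancel_left)
  then show ?thesis by simp
qed

text \<open>The product with a test function is again a test function, and the integral of its partial derivative
vanishes.\<close>

lemma integral_by_parts_smooth:
  assumes q: "smooth q" and \<phi>: "\<phi> \<in> test_functions U"
  shows "(LINT x:U|lebesgue. q x * partial_deriv i \<phi> x) = - (LINT x:U|lebesgue. partial_deriv i q x * \<phi> x)"
proof -
  have \<phi>': "(\<lambda>x. q x * \<phi> x) \<in> test_functions U" by (rule test_function_mult[OF q \<phi>])
  have sm: "smooth \<phi>" using \<phi> by (rule smooth_test)
  have pd: "partial_deriv i (\<lambda>x. q x * \<phi> x) x = q x * partial_deriv i \<phi> x + partial_deriv i q x * \<phi> x" for x
    using q sm by (intro partial_deriv_mult smooth_imp_differentiable)
  have t: "(\<lambda>x. q x * partial_deriv i \<phi> x) \<in> test_functions U"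
    "(\<lambda>x. partial_deriv i q x * \<phi> x) \<in> test_functions U"
    using q \<phi> by (auto intro: test_function_mult test_function_partial_deriv smooth_partial_deriv)
  have eq: "(LINT x:U|lebesgue. \<psi> x) = (\<integral>x. \<psi> x \<partial>lborel)" if "\<psi> \<in> test_functions U" for \<psi>
  proof -
    have "(LINT x:U|lebesgue. \<psi> x) = (\<integral>x. \<psi> x \<partial>lebesgue)"
      unfolding set_lebesgue_integral_def using test_function_zero_outside[OF that]
      by (intro Bochner_Integration.integral_cong) (auto simp: indicator_def)
    also have "\<dots> = (\<integral>x. \<psi> x \<partial>lborel)"
      using borel_measurable_smooth[OF smooth_test[OF that]] by (intro integral_completion) simp
    finally show ?thesis .
  qed
  have "0 = (\<integral>x. q x * partial_deriv i \<phi> x + partial_deriv i q x * \<phi> x \<partial>lborel)"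
    using integral_partial_deriv_test_function[OF \<phi>', of i] by (simp add: pd)
  also have "\<dots> = (\<integral>x. q x * partial_deriv i \<phi> x \<partial>lborel) + (\<integral>x. partial_deriv i q x * \<phi> x \<partial>lborel)"
    by (intro Bochner_Integration.integral_add integrable_test_function[OF t(1)] integrable_test_function[OF t(2)])
  finally show ?thesis by (simp add: eq[OF t(1)] eq[OF t(2)])
qed

lemma has_weak_deriv_smooth:
  assumes q: "smooth q"
  shows "has_weak_deriv U \<alpha> q (multi_partial \<alpha> q)"
  unfolding has_weak_deriv_def
proof (intro conjI ballI locally_integrable_continuous smooth_imp_continuous_on smooth_multi_partial q)
  fix \<phi> assume \<phi>: "\<phi> \<in> test_functions U"
  obtain l where l: "\<And>i. count_list l i = \<alpha> i" using ex_list_count[of \<alpha>] by auto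
  have "(LINT x:U|lebesgue. q x * foldr partial_deriv l \<phi> x)
      = (-1) ^ length l * (LINT x:U|lebesgue. foldr partial_deriv l q x * \<phi> x)"
    using q
  proof (induction l arbitrary: q)
    case (Cons i l)
    have t: "foldr partial_deriv l \<phi> \<in> test_functions U"
      by (induction l) (auto intro: test_function_partial_deriv \<phi>)
    show ?case
      using Cons.IH[OF smooth_partial_deriv[OF Cons.prems]] integral_by_parts_smooth[OF Cons.prems t, of i]
        partial_deriv_foldr[OF Cons.prems, of i l]
      by simp
  qed simp
  then show "(LINT x:U|lebesgue. q x * multi_partial \<alpha> \<phi> x) = (-1) ^ mi_abs \<alpha> * (LINT x:U|lebesgue. multi_partial \<alpha> q x * \<phi> x)"
    using multi_partial_eq_foldr[OF smooth_test[OF \<phi>] l] multi_partial_eq_foldr[OF q l] mi_abs_count_list[OF l]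
    by simp
qed

section \<open>Functions in Lp up to null sets\<close>

text \<open>Lebesgue measure is complete, so measurability itself passes between functions that agree almost
everywhere. This lets weak derivatives, which are only known up to null sets, be exchanged freely
under integrals.\<close>

lemma lebesgue_cong_AE:
  fixes f g :: "'a::euclidean_space \<Rightarrow> real"
  assumes ae: "AE x in lebesgue. f x = g x"
  shows lebesgue_integral_cong_AE: "integral\<^sup>L lebesgue f = integral\<^sup>L lebesgue g"
    and lebesgue_integrable_cong_AE: "integrable lebesgue f \<longleftrightarrow> integrable lebesgue g"
proof -
  have ae': "AE x in lebesgue. g x = f x" using ae by eventually_elim simp
  have m: "f \<in> borel_measurable lebesgue \<longleftrightarrow> g \<in> borel_measurable lebesgue"
    using borel_measurable_AE[OF _ ae] borel_measurable_AE[OF _ ae'] by blast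
  show i: "integrable lebesgue f \<longleftrightarrow> integrable lebesgue g"
  proof (cases "f \<in> borel_measurable lebesgue")
    case True
    with m ae show ?thesis by (intro integrable_cong_AE) auto
  next
    case False
    with m show ?thesis using borel_measurable_integrable by blast
  qed
  show "integral\<^sup>L lebesgue f = integral\<^sup>L lebesgue g"
  proof (cases "integrable lebesgue f")
    case True
    with i ae show ?thesis by (intro integral_cong_AE) auto
  next
    case False
    with i show ?thesis by (simp add: not_integrable_integral_eq)
  qed
qed

lemma set_lebesgue_integral_cong_AE_on:
  assumes "AE x in lebesgue. x \<in> U \<longrightarrow> f x = g x"
  shows "(LINT x:U|lebesgue. f x) = (LINT x:U|lebesgue. g x :: real)"
  unfolding set_lebesgue_integral_def
  by (rule lebesgue_integral_cong_AE) (use assms in \<open>eventually_elim, auto simp: indicator_def\<close>)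

lemma set_lebesgue_integral_cbox_box:
  "(LINT x:cbox a b|lebesgue. f x) = (LINT x:box a b|lebesgue. f x :: real)"
  unfolding set_lebesgue_integral_def
proof (rule lebesgue_integral_cong_AE)
  have "AE x in lebesgue. x \<notin> cbox a b - box a b"
    by (rule AE_not_in) (simp add: negligible_iff_null_sets[symmetric] negligible_frontier_interval)
  then show "AE x in lebesgue. indicator (cbox a b) x *\<^sub>R f x = indicator (box a b) x *\<^sub>R f x"
    by eventually_elim (use box_subset_cbox[of a b] in \<open>auto simp: indicator_def\<close>)
qed

lemma Lp_space_iff:
  "f \<in> Lp_space p U \<longleftrightarrow> (\<lambda>x. indicator U x * f x) \<in> borel_measurable lebesgue \<and>
     integrable lebesgue (\<lambda>x. indicator U x * \<bar>f x\<bar> powr p)"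
  by (simp add: Lp_space_def set_borel_measurable_def set_integrable_def)

lemma Lp_space_cong_AE:
  assumes f: "f \<in> Lp_space p U" and ae: "AE x in lebesgue. x \<in> U \<longrightarrow> f x = g x"
  shows "g \<in> Lp_space p U"
proof -
  have ae1: "AE x in lebesgue. indicator U x * f x = indicator U x * g x"
    using ae by eventually_elim (auto simp: indicator_def)
  have "(\<lambda>x. indicator U x * f x) \<in> borel_measurable lebesgue" using f by (simp add: Lp_space_iff)
  from borel_measurable_AE[OF this ae1]
  have "(\<lambda>x. indicator U x * g x) \<in> borel_measurable lebesgue" .
  moreover have ae2: "AE x in lebesgue. indicator U x * \<bar>f x\<bar> powr p = indicator U x * \<bar>g x\<bar> powr p"
    using ae by eventually_elim (auto simp: indicator_def)
  have "integrable lebesgue (\<lambda>x. indicator U x * \<bar>g x\<bar> powr p)"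
    using lebesgue_integrable_cong_AE[OF ae2] f by (simp add: Lp_space_iff)
  ultimately show ?thesis by (simp add: Lp_space_iff)
qed

lemma Lp_space_subset:
  assumes f: "f \<in> Lp_space p U" and V: "V \<subseteq> U" "V \<in> sets lebesgue"
  shows "f \<in> Lp_space p V"
proof -
  have "(\<lambda>x. indicator V x * (indicator U x * f x)) \<in> borel_measurable lebesgue"
    using f V by (intro borel_measurable_times[of "indicator V"] borel_measurable_indicator) (simp_all add: Lp_space_iff)
  moreover have "integrable lebesgue (\<lambda>x. indicator V x *\<^sub>R (indicator U x * \<bar>f x\<bar> powr p))"
    using f V by (intro integrable_mult_indicator) (auto simp: Lp_space_iff)
  moreover have "indicator V x * (indicator U x * c) = indicator V x * (c :: real)" for x c
    using V by (auto simp: indicator_def)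
  ultimately show ?thesis by (simp add: Lp_space_iff)
qed

lemma abs_le_1_plus_abs_powr:
  fixes t :: real
  assumes "1 \<le> p"
  shows "\<bar>t\<bar> \<le> 1 + \<bar>t\<bar> powr p"
proof (cases "\<bar>t\<bar> \<le> 1")
  case False
  then have "\<bar>t\<bar> powr 1 \<le> \<bar>t\<bar> powr p" using assms by (intro powr_mono) auto
  with False show ?thesis by simp
qed (simp add: add_increasing2)

lemma integrable_indicator_bounded:
  assumes "U \<in> sets lebesgue" "bounded (U :: 'a::euclidean_space set)"
  shows "integrable lebesgue (\<lambda>x. indicator U x :: real)"
  using bounded_set_imp_lmeasurable[OF assms(2,1)]
  by (intro integrable_real_indicator) (auto simp: fmeasurable_def simp del: emeasure_completion)

lemma Lp_space_integrable:
  assumes p: "1 \<le> p" and f: "f \<in> Lp_space p U" and U: "U \<in> sets lebesgue" "bounded U"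
  shows "set_integrable lebesgue U f"
  unfolding set_integrable_def
proof (rule Bochner_Integration.integrable_bound)
  show "integrable lebesgue (\<lambda>x. indicator U x + indicator U x * \<bar>f x\<bar> powr p)"
    using f integrable_indicator_bounded[OF U] by (intro Bochner_Integration.integrable_add) (auto simp: Lp_space_iff)
  show "AE x in lebesgue. norm (indicator U x *\<^sub>R f x) \<le> norm (indicator U x + indicator U x * \<bar>f x\<bar> powr p)"
    using abs_le_1_plus_abs_powr[OF p] by (intro AE_I2) (auto simp: indicator_def add_nonneg_nonneg)
qed (use f in \<open>simp add: Lp_space_iff\<close>)

lemma Lp_space_diff_continuous:
  fixes q :: "real^'n::finite \<Rightarrow> real"
  assumes p: "1 \<le> p" and f: "f \<in> Lp_space p U" and U: "U \<in> sets lebesgue" "bounded U"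
    and q: "continuous_on UNIV q"
  shows "(\<lambda>x. f x - q x) \<in> Lp_space p U"
proof -
  have [measurable]: "q \<in> borel_measurable lebesgue"
    using q by (intro borel_measurable_lebesgue_of_borel borel_measurable_continuous_onI)
  have "compact (q ` closure U)"
    using U q by (intro compact_continuous_image) (auto intro: continuous_on_subset simp: compact_closure)
  then obtain B where B: "\<forall>y\<in>q ` closure U. norm y \<le> B"
    using compact_imp_bounded bounded_iff by metis
  have qB: "\<bar>q x\<bar> \<le> \<bar>B\<bar>" if "x \<in> U" for x
  proof -
    have "q x \<in> q ` closure U" using that closure_subset by blast
    with B have "norm (q x) \<le> B" by blast
    then show ?thesis by simp
  qed
  have iU [measurable]: "(indicator U :: _ \<Rightarrow> real) \<in> borel_measurable lebesgue"
    using U(1) by (rule borel_measurable_indicator)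
  have fm [measurable]: "(\<lambda>x. indicator U x * f x) \<in> borel_measurable lebesgue" using f by (simp add: Lp_space_iff)
  have m: "(\<lambda>x. indicator U x * (f x - q x)) \<in> borel_measurable lebesgue"
    unfolding right_diff_distrib by measurable
  have bound: "\<bar>s - t\<bar> powr p \<le> 2 powr p * (\<bar>s\<bar> powr p + \<bar>t\<bar> powr p)" for s t :: real
  proof -
    have "\<bar>s - t\<bar> \<le> 2 * max \<bar>s\<bar> \<bar>t\<bar>" by auto
    then have "\<bar>s - t\<bar> powr p \<le> (2 * max \<bar>s\<bar> \<bar>t\<bar>) powr p" using p by (intro powr_mono2) auto
    also have "\<dots> = 2 powr p * (max \<bar>s\<bar> \<bar>t\<bar>) powr p" by (simp add: powr_mult)
    also have "(max \<bar>s\<bar> \<bar>t\<bar>) powr p \<le> \<bar>s\<bar> powr p + \<bar>t\<bar> powr p" by (simp add: max_def)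
    finally show ?thesis by simp
  qed
  have "integrable lebesgue (\<lambda>x. indicator U x * \<bar>f x - q x\<bar> powr p)"
  proof (rule Bochner_Integration.integrable_bound)
    show "integrable lebesgue (\<lambda>x. 2 powr p * (indicator U x * \<bar>f x\<bar> powr p) + (2 powr p * \<bar>B\<bar> powr p) * indicator U x)"
      using f integrable_indicator_bounded[OF U]
      by (intro Bochner_Integration.integrable_add integrable_mult_right) (auto simp: Lp_space_iff)
    have "(\<lambda>x. indicator U x * \<bar>indicator U x * (f x - q x)\<bar> powr p) \<in> borel_measurable lebesgue"
      using m iU by measurable
    moreover have "indicator U x * \<bar>indicator U x * (f x - q x)\<bar> powr p = indicator U x * \<bar>f x - q x\<bar> powr p" for x
      by (simp add: indicator_def)
    ultimately show "(\<lambda>x. indicator U x * \<bar>f x - q x\<bar> powr p) \<in> borel_measurable lebesgue" by simp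
    show "AE x in lebesgue. norm (indicator U x * \<bar>f x - q x\<bar> powr p)
        \<le> norm (2 powr p * (indicator U x * \<bar>f x\<bar> powr p) + (2 powr p * \<bar>B\<bar> powr p) * indicator U x)"
    proof (rule AE_I2)
      fix x
      show "norm (indicator U x * \<bar>f x - q x\<bar> powr p)
        \<le> norm (2 powr p * (indicator U x * \<bar>f x\<bar> powr p) + (2 powr p * \<bar>B\<bar> powr p) * indicator U x)"
      proof (cases "x \<in> U")
        case True
        have "\<bar>f x - q x\<bar> powr p \<le> 2 powr p * (\<bar>f x\<bar> powr p + \<bar>q x\<bar> powr p)" by (rule bound)
        also have "\<dots> \<le> 2 powr p * (\<bar>f x\<bar> powr p + \<bar>B\<bar> powr p)"
          using p qB[OF True] by (intro mult_left_mono add_left_mono powr_mono2) auto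
        finally show ?thesis using True by (simp add: distrib_left add_nonneg_nonneg)
      qed simp
    qed
  qed
  with m show ?thesis by (simp add: Lp_space_iff)
qed

text \<open>Fubini's theorem and Jensen's inequality are applied on products of Borel measures. A Borel function
that vanishes off the set and agrees with the given one almost everywhere on it brings the problem there.\<close>

lemma borel_representative:
  assumes "f \<in> Lp_space p U" "U \<in> sets borel"
  obtains f' where "f' \<in> borel_measurable borel" "\<And>x. x \<notin> U \<Longrightarrow> f' x = 0"
    "AE x in lebesgue. indicator U x * f x = f' x"
proof -
  have "(\<lambda>x. indicator U x * f x) \<in> borel_measurable (completion lborel)"
    using assms by (simp add: Lp_space_iff)
  from completion_ex_borel_measurable_real[OF this] obtain g
    where g: "g \<in> borel_measurable lborel" "AE x in lborel. indicator U x * f x = g x" by blast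
  show ?thesis
  proof (rule that[of "\<lambda>x. indicator U x * g x"])
    show "(\<lambda>x. indicator U x * g x) \<in> borel_measurable borel"
      using g(1) assms(2) by (intro borel_measurable_times borel_measurable_indicator) auto
    show "AE x in lebesgue. indicator U x * f x = indicator U x * g x"
      using AE_completion[OF g(2)] by eventually_elim (auto simp: indicator_def)
  qed simp
qed

section \<open>The anisotropic Poincare inequality on a box\<close>

lemma abs_sum_powr_le:
  fixes t :: "'n::finite \<Rightarrow> real"
  assumes p: "1 \<le> p"
  shows "\<bar>\<Sum>i\<in>UNIV. t i\<bar> powr p \<le> real CARD('n) powr p * (\<Sum>i\<in>UNIV. \<bar>t i\<bar> powr p)"
proof -
  define m where "m = Max (range (\<lambda>i. \<bar>t i\<bar>))"
  have "m \<in> range (\<lambda>i. \<bar>t i\<bar>)" unfolding m_def by (rule Max_in) auto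
  then obtain k where k: "m = \<bar>t k\<bar>" by auto
  have le: "\<bar>t i\<bar> \<le> m" for i unfolding m_def by (rule Max_ge) auto
  have "\<bar>\<Sum>i\<in>UNIV. t i\<bar> \<le> (\<Sum>i\<in>(UNIV::'n set). m)"
    by (rule order_trans[OF sum_abs]) (intro sum_mono le)
  then have "\<bar>\<Sum>i\<in>UNIV. t i\<bar> powr p \<le> (real CARD('n) * m) powr p"
    using p by (intro powr_mono2) auto
  also have "\<dots> = real CARD('n) powr p * \<bar>t k\<bar> powr p" by (simp add: k powr_mult)
  also have "\<dots> \<le> real CARD('n) powr p * (\<Sum>i\<in>UNIV. \<bar>t i\<bar> powr p)"
    by (intro mult_left_mono member_le_sum) auto
  finally show ?thesis .
qed

text \<open>The power function is convex on the open half-line by its second derivative; this extends to the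
boundary point 0 because \<open>s powr p \<le> s\<close> on the unit interval.\<close>

lemma convex_on_abs_powr:
  assumes p: "1 \<le> p"
  shows "convex_on UNIV (\<lambda>x::real. \<bar>x\<bar> powr p)"
proof (rule convex_onI)
  fix t x y :: real
  assume t: "0 < t" "t < 1"
  have "\<bar>(1 - t) *\<^sub>R x + t *\<^sub>R y\<bar> \<le> (1 - t) * \<bar>x\<bar> + t * \<bar>y\<bar>"
    using abs_triangle_ineq[of "(1 - t) * x" "t * y"] t by (simp add: abs_mult)
  then have "\<bar>(1 - t) *\<^sub>R x + t *\<^sub>R y\<bar> powr p \<le> ((1 - t) * \<bar>x\<bar> + t * \<bar>y\<bar>) powr p"
    using p by (intro powr_mono2) auto
  also have "\<dots> \<le> (1 - t) * \<bar>x\<bar> powr p + t * \<bar>y\<bar> powr p"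
  proof -
    have small: "s powr p \<le> s" if "0 \<le> s" "s \<le> 1" for s :: real
      using powr_mono'[OF p that] that by simp
    consider "x = 0" | "y = 0" | "x \<noteq> 0" "y \<noteq> 0" by blast
    then show ?thesis
    proof cases
      case 1 with t small[of t] p show ?thesis by (simp add: powr_mult mult_right_mono)
    next
      case 2 with t small[of "1 - t"] p show ?thesis by (simp add: powr_mult mult_right_mono)
    next
      case 3
      with convex_onD[OF powr_convex[OF p], of t "\<bar>x\<bar>" "\<bar>y\<bar>"] t show ?thesis by simp
    qed
  qed
  finally show "\<bar>(1 - t) *\<^sub>R x + t *\<^sub>R y\<bar> powr p \<le> (1 - t) * \<bar>x\<bar> powr p + t * \<bar>y\<bar> powr p" .
qed simp

text \<open>Stated with a non-negative integral on the right so that no integrability has to be known: if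
\<^term>\<open>X\<close> is not integrable the left side is 0, and if \<open>\<bar>X\<bar>\<^sup>p\<close> is not, the right side is infinite.\<close>

lemma (in prob_space) jensen_powr_nn:
  fixes X :: "'a \<Rightarrow> real"
  assumes p: "1 \<le> p" and [measurable]: "X \<in> borel_measurable M"
  shows "ennreal (\<bar>\<integral>x. X x \<partial>M\<bar> powr p) \<le> (\<integral>\<^sup>+x. ennreal (\<bar>X x\<bar> powr p) \<partial>M)"
proof (cases "integrable M X \<and> integrable M (\<lambda>x. \<bar>X x\<bar> powr p)")
  case True
  then have "\<bar>\<integral>x. X x \<partial>M\<bar> powr p \<le> (\<integral>x. \<bar>X x\<bar> powr p \<partial>M)"
    by (intro jensens_inequality[of X UNIV]) (auto intro: convex_on_abs_powr p)
  then have "ennreal (\<bar>\<integral>x. X x \<partial>M\<bar> powr p) \<le> ennreal (\<integral>x. \<bar>X x\<bar> powr p \<partial>M)"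
    by (rule ennreal_leI)
  also have "\<dots> = (\<integral>\<^sup>+x. ennreal (\<bar>X x\<bar> powr p) \<partial>M)"
    using True by (intro nn_integral_eq_integral[symmetric]) auto
  finally show ?thesis .
next
  case False
  show ?thesis
  proof (cases "integrable M X")
    case True
    with False have "\<not> integrable M (\<lambda>x. \<bar>X x\<bar> powr p)" by simp
    then have "(\<integral>\<^sup>+x. ennreal (\<bar>X x\<bar> powr p) \<partial>M) = \<infinity>"
      by (simp add: integrable_iff_bounded not_less top_unique)
    then show ?thesis by simp
  qed (use p in \<open>simp add: not_integrable_integral_eq\<close>)
qed

lemma jensen_powr_set:
  fixes X :: "'a::euclidean_space \<Rightarrow> real"
  assumes p: "1 \<le> p" and [measurable]: "X \<in> borel_measurable borel" "A \<in> sets borel"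
    and A: "emeasure lborel A = ennreal m" "m > 0"
  shows "ennreal (\<bar>\<integral>x. X x * (indicator A x / m) \<partial>lborel\<bar> powr p)
     \<le> (\<integral>\<^sup>+x. ennreal (\<bar>X x\<bar> powr p * (indicator A x / m)) \<partial>lborel)"
proof -
  define N where "N = density lborel (\<lambda>x. ennreal (indicator A x / m))"
  have "emeasure N (space N) = (\<integral>\<^sup>+x. ennreal (1 / m) * indicator A x \<partial>lborel)"
    unfolding N_def by (auto simp: emeasure_density indicator_def intro!: nn_integral_cong)
  also have "\<dots> = 1"
    using A by (simp add: nn_integral_cmult ennreal_mult[symmetric])
  finally interpret prob_space N by (rule prob_spaceI)
  have "(\<integral>x. X x \<partial>N) = (\<integral>x. X x * (indicator A x / m) \<partial>lborel)"
    unfolding N_def using A(2) by (subst integral_density) (auto simp: mult.commute)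
  moreover have "(\<integral>\<^sup>+x. ennreal (\<bar>X x\<bar> powr p) \<partial>N)
      = (\<integral>\<^sup>+x. ennreal (\<bar>X x\<bar> powr p * (indicator A x / m)) \<partial>lborel)"
    unfolding N_def using A(2)
    by (subst nn_integral_density) (auto simp: ennreal_mult'[symmetric] mult.commute)
  moreover have "X \<in> borel_measurable N" by (simp add: N_def)
  ultimately show ?thesis using jensen_powr_nn[OF p, of X] by simp
qed

text \<open>The fundamental theorem of calculus for weak derivatives along almost every segment of direction
\<^term>\<open>z\<close>. Both sides are compared through their pairings with a test function \<open>\<phi>\<close> supported where \<open>x\<close> and
\<open>x + z\<close> lie in \<^term>\<open>Q\<close>. The differences can be moved onto \<open>\<phi>\<close>; by convexity all its intermediate translates
are again test functions on \<^term>\<open>Q\<close>, so the weak derivative applies to each of them.\<close>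

lemma weak_gradient_difference:
  fixes w :: "real^'n::finite \<Rightarrow> real" and g :: "'n \<Rightarrow> real^'n \<Rightarrow> real"
  assumes Q: "open Q" "convex Q"
    and w: "integrable lborel w" and g: "\<And>i. integrable lborel (g i)"
    and parts: "\<And>i \<phi>. \<phi> \<in> test_functions Q \<Longrightarrow>
      (\<integral>x. w x * partial_deriv i \<phi> x \<partial>lborel) = - (\<integral>x. g i x * \<phi> x \<partial>lborel)"
  shows "AE x in lborel. x \<in> Q \<and> x + z \<in> Q \<longrightarrow>
    w (x + z) - w x = (\<integral>s. (\<Sum>i\<in>UNIV. z $ i * g i (x + s *\<^sub>R z)) * indicator {0..1} s \<partial>lborel)"
proof -
  have [measurable]: "w \<in> borel_measurable borel" "g i \<in> borel_measurable borel" for i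
    using w g[of i] by auto
  define G where "G y = (\<Sum>i\<in>UNIV. z $ i * g i y)" for y
  have G: "integrable lborel G" unfolding G_def using g by auto
  then have [measurable]: "G \<in> borel_measurable borel" by auto
  define h where "h = (\<lambda>(s, x). G (x + s *\<^sub>R z) * indicator {0..1} (s::real))"
  have hm: "h \<in> borel_measurable (lborel \<Otimes>\<^sub>M lborel)" unfolding h_def by measurable
  have h: "integrable (lborel \<Otimes>\<^sub>M lborel) h"
  proof (rule integrable_unit_interval_pair)
    show "h \<in> borel_measurable borel" using hm by (simp add: lborel_prod)
    fix s :: real
    have "(\<integral>\<^sup>+x. norm (h (s, x)) \<partial>lborel) = (\<integral>\<^sup>+x. ennreal \<bar>G (x + s *\<^sub>R z)\<bar> \<partial>lborel) * indicator {0..1} s"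
      by (subst nn_integral_multc[symmetric]) (auto simp: h_def indicator_def intro!: nn_integral_cong)
    also have "(\<integral>\<^sup>+x. ennreal \<bar>G (x + s *\<^sub>R z)\<bar> \<partial>lborel) = (\<integral>\<^sup>+x. ennreal \<bar>G x\<bar> \<partial>lborel)"
      by (rule nn_integral_translate) simp
    also have "\<dots> = ennreal (\<integral>x. \<bar>G x\<bar> \<partial>lborel)" using G by (intro nn_integral_eq_integral) auto
    finally show "(\<integral>\<^sup>+x. norm (h (s, x)) \<partial>lborel) \<le> ennreal (\<integral>x. \<bar>G x\<bar> \<partial>lborel) * indicator {0..1} s"
      by simp
  qed
  define I where "I x = (\<integral>s. h (s, x) \<partial>lborel)" for x
  have I: "integrable lborel I"
    unfolding I_def using lborel_pair.integrable_snd[of "\<lambda>s x. h (s, x)"] h by simp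
  define f where "f x = w (x + z) - w x - I x" for x
  have f: "integrable lborel f" unfolding f_def using w I integrable_translate[OF w] by auto
  define U where "U = Q \<inter> (\<lambda>x. x + z) -` Q"
  have "open U" unfolding U_def
    by (intro open_Int Q(1) open_vimage continuous_intros)
  have seg: "x + s *\<^sub>R z \<in> Q" if "x \<in> U" "0 \<le> s" "s \<le> 1" for x s
  proof -
    have "(1 - s) *\<^sub>R x + s *\<^sub>R (x + z) \<in> Q"
      using that Q(2) by (intro convexD) (auto simp: U_def)
    then show ?thesis by (simp add: algebra_simps)
  qed
  have "AE x in lebesgue. x \<in> U \<longrightarrow> f x = 0"
  proof (rule fundamental_lemma_of_variations[OF \<open>open U\<close>])
    have "integrable lebesgue f" using f by (subst integrable_completion) auto
    then show "locally_integrable U f"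
      unfolding locally_integrable_def set_integrable_def
      by (intro allI impI integrable_mult_indicator) (auto intro: lmeasurable_compact fmeasurableD)
    fix \<phi> assume \<phi>: "\<phi> \<in> test_functions U"
    obtain B where B: "\<And>x. \<bar>\<phi> x\<bar> \<le> B" using test_function_bounded[OF \<phi>] by blast
    have [measurable]: "\<phi> \<in> borel_measurable borel" by (rule borel_measurable_smooth[OF smooth_test[OF \<phi>]])
    have \<phi>': "\<phi> \<in> test_functions UNIV" using \<phi> test_functions_mono by blast
    have shifted: "(\<integral>x. w x * partial_deriv i \<phi> (x + s *\<^sub>R (- z)) \<partial>lborel)
        = - (\<integral>x. g i (x + s *\<^sub>R z) * \<phi> x \<partial>lborel)" if s: "0 \<le> s" "s \<le> 1" for s i
    proof -
      have t: "(\<lambda>x. \<phi> (x + s *\<^sub>R (- z))) \<in> test_functions Q"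
        by (rule test_function_translate[OF \<phi>]) (use seg s in auto)
      have "(\<integral>x. w x * partial_deriv i \<phi> (x + s *\<^sub>R (- z)) \<partial>lborel)
          = - (\<integral>x. g i x * \<phi> (x + s *\<^sub>R (- z)) \<partial>lborel)"
        using parts[OF t, of i] by (simp only: partial_deriv_translate)
      also have "(\<integral>x. g i x * \<phi> (x + s *\<^sub>R (- z)) \<partial>lborel) = (\<integral>x. g i (x + s *\<^sub>R z) * \<phi> x \<partial>lborel)"
        using integral_translate[of "\<lambda>x. g i x * \<phi> (x + s *\<^sub>R (- z))" "s *\<^sub>R z"] by simp
      finally show ?thesis .
    qed
    have gi: "integrable lborel (\<lambda>x. g i (x + v) * \<phi> x)" for i v
      by (intro integrable_mult_bounded[OF _ _ B] integrable_translate g) auto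
    have "(\<integral>x. (w (x + z) - w x) * \<phi> x \<partial>lborel) = (\<integral>x. w (x + z) * \<phi> x \<partial>lborel) - (\<integral>x. w x * \<phi> x \<partial>lborel)"
      unfolding left_diff_distrib
      by (intro Bochner_Integration.integral_diff integrable_mult_bounded[OF _ _ B] integrable_translate w) auto
    also have "(\<integral>x. w (x + z) * \<phi> x \<partial>lborel) = (\<integral>x. w x * \<phi> (x + (- z)) \<partial>lborel)"
      using integral_translate[of "\<lambda>x. w x * \<phi> (x + (- z))" z] by simp
    also have "(\<integral>x. w x * \<phi> (x + (- z)) \<partial>lborel) - (\<integral>x. w x * \<phi> x \<partial>lborel)
        = (\<integral>x. w x * (\<phi> (x + (- z)) - \<phi> x) \<partial>lborel)"
      unfolding right_diff_distrib
      by (intro Bochner_Integration.integral_diff[symmetric] integrable_mult_bounded[OF w, where B = B] B) auto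
    also have "\<dots> = (\<integral>s. (\<Sum>i\<in>UNIV. (- z) $ i * (\<integral>x. w x * partial_deriv i \<phi> (x + s *\<^sub>R (- z)) \<partial>lborel)) * indicator {0..1} s \<partial>lborel)"
      by (rule integral_shift_difference[OF w \<phi>'])
    also have "\<dots> = (\<integral>s. (\<integral>x. h (s, x) * \<phi> x \<partial>lborel) \<partial>lborel)"
    proof (intro Bochner_Integration.integral_cong refl)
      fix s :: real
      have "(\<integral>x. h (s, x) * \<phi> x \<partial>lborel) = (\<integral>x. (\<Sum>i\<in>UNIV. z $ i * (g i (x + s *\<^sub>R z) * \<phi> x)) * indicator {0..1} s \<partial>lborel)"
      proof (rule Bochner_Integration.integral_cong[OF refl])
        fix x
        have "(\<Sum>i\<in>UNIV. z $ i * (g i (x + s *\<^sub>R z) * \<phi> x)) = G (x + s *\<^sub>R z) * \<phi> x"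
          by (simp add: G_def sum_distrib_right mult.assoc)
        then show "h (s, x) * \<phi> x = (\<Sum>i\<in>UNIV. z $ i * (g i (x + s *\<^sub>R z) * \<phi> x)) * indicator {0..1} s"
          by (simp add: h_def)
      qed
      also have "\<dots> = (\<Sum>i\<in>UNIV. z $ i * (\<integral>x. g i (x + s *\<^sub>R z) * \<phi> x \<partial>lborel)) * indicator {0..1} s"
        using gi by simp
      finally show "(\<Sum>i\<in>UNIV. (- z) $ i * (\<integral>x. w x * partial_deriv i \<phi> (x + s *\<^sub>R (- z)) \<partial>lborel)) * indicator {0..1} s
          = (\<integral>x. h (s, x) * \<phi> x \<partial>lborel)"
        using shifted[of s] by (cases "s \<in> {0..1}") auto
    qed
    also have "\<dots> = (\<integral>x. (\<integral>s. h (s, x) * \<phi> x \<partial>lborel) \<partial>lborel)"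
    proof -
      have "integrable (lborel \<Otimes>\<^sub>M lborel) (\<lambda>y. h y * \<phi> (snd y))"
        by (rule integrable_mult_bounded[OF h _ B]) simp
      then show ?thesis
        using lborel_pair.Fubini_integral[of "\<lambda>s x. h (s, x) * \<phi> x"] by (simp add: case_prod_unfold)
    qed
    also have "\<dots> = (\<integral>x. I x * \<phi> x \<partial>lborel)" by (simp add: I_def)
    finally have "(\<integral>x. (w (x + z) - w x) * \<phi> x \<partial>lborel) - (\<integral>x. I x * \<phi> x \<partial>lborel) = 0" by simp
    moreover have "(\<integral>x. f x * \<phi> x \<partial>lborel) = (\<integral>x. (w (x + z) - w x) * \<phi> x \<partial>lborel) - (\<integral>x. I x * \<phi> x \<partial>lborel)"
      unfolding f_def left_diff_distrib[of _ "I _"]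
      by (intro Bochner_Integration.integral_diff integrable_mult_bounded[OF _ _ B] I
             Bochner_Integration.integrable_diff integrable_translate w) auto
    ultimately have "(\<integral>x. f x * \<phi> x \<partial>lborel) = 0" by simp
    moreover have "(LINT x:U|lebesgue. f x * \<phi> x) = (\<integral>x. f x * \<phi> x \<partial>lebesgue)"
      unfolding set_lebesgue_integral_def using test_function_zero_outside[OF \<phi>]
      by (intro Bochner_Integration.integral_cong refl) (auto simp: indicator_def)
    moreover have "(\<integral>x. f x * \<phi> x \<partial>lebesgue) = (\<integral>x. f x * \<phi> x \<partial>lborel)"
      using f by (intro integral_completion) auto
    ultimately show "(LINT x:U|lebesgue. f x * \<phi> x) = 0" by simp
  qed
  then have "AE x in lborel. x \<in> U \<longrightarrow> f x = 0" by (simp add: AE_completion_iff)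
  then show ?thesis
    by eventually_elim (auto simp: U_def f_def I_def h_def G_def)
qed

text \<open>A function of mean zero satisfies \<open>\<bar>w y\<bar>\<^sup>p \<le> avg\<^sub>x \<bar>w y - w x\<bar>\<^sup>p\<close> by Jensen. Substituting \<open>y = x + z\<close> and using the
previous lemma for each fixed \<open>z\<close> bounds the spatial integral by \<open>\<integral> H\<close>, where \<open>H\<close> already carries the side
lengths because \<open>\<bar>z\<^sub>i\<bar>\<close> is at most the \<open>i\<close>-th side length. The admissible \<open>z\<close> fill a box of volume \<open>2\<^sup>n \<bar>Q\<bar>\<close>, and the
factor \<open>\<bar>Q\<bar>\<close> cancels against the averaging. Working with all directions at once keeps the constant
independent of the aspect ratio, without rescaling to a reference cube.\<close>

lemma poincare_box_borel:
  fixes w :: "real^'n::finite \<Rightarrow> real" and g :: "'n \<Rightarrow> real^'n \<Rightarrow> real"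
  assumes p: "1 \<le> p" and ne: "box a b \<noteq> {}"
    and w: "integrable lborel w" and g: "\<And>i. integrable lborel (g i)"
    and w0: "\<And>x. x \<notin> box a b \<Longrightarrow> w x = 0"
    and mean: "(\<integral>x. w x \<partial>lborel) = 0"
    and parts: "\<And>i \<phi>. \<phi> \<in> test_functions (box a b) \<Longrightarrow>
      (\<integral>x. w x * partial_deriv i \<phi> x \<partial>lborel) = - (\<integral>x. g i x * \<phi> x \<partial>lborel)"
  shows "(\<integral>\<^sup>+x. ennreal (\<bar>w x\<bar> powr p) \<partial>lborel) \<le> ennreal (2 ^ CARD('n)) *
     (\<integral>\<^sup>+x. ennreal (real CARD('n) powr p * (\<Sum>i\<in>UNIV. (b $ i - a $ i) powr p * \<bar>g i x\<bar> powr p)) \<partial>lborel)"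
proof -
  define Q where "Q = box a b"
  define H where "H x = real CARD('n) powr p * (\<Sum>i\<in>UNIV. (b $ i - a $ i) powr p * \<bar>g i x\<bar> powr p)" for x
  have [measurable]: "w \<in> borel_measurable borel" "g i \<in> borel_measurable borel" for i
    using w g[of i] by auto
  have [measurable]: "H \<in> borel_measurable borel" unfolding H_def by measurable
  have [measurable]: "Q \<in> sets borel" by (simp add: Q_def)
  define m where "m = measure lborel Q"
  have em: "emeasure lborel Q = ennreal m"
    unfolding m_def Q_def by (intro emeasure_eq_ennreal_measure) (simp add: emeasure_lborel_box_eq)
  have m: "m > 0"
    using ne by (simp add: m_def Q_def measure_lborel_box_eq box_ne_empty prod_pos less_imp_le inner_diff_left)
  define D where "D = box (a - b) (b - a)"
  have [measurable]: "D \<in> sets borel" by (simp add: D_def)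
  have eD: "emeasure lborel D = ennreal (2 ^ CARD('n) * m)"
  proof -
    have *: "a \<bullet> i < b \<bullet> i" if "i \<in> Basis" for i using ne that by (simp add: box_ne_empty)
    have "emeasure lborel D = ennreal (\<Prod>i\<in>Basis. ((b - a) - (a - b)) \<bullet> i)"
      unfolding D_def by (intro emeasure_lborel_box) (use * in \<open>auto simp: inner_diff_left less_imp_le\<close>)
    also have "(\<Prod>i\<in>Basis. ((b - a) - (a - b)) \<bullet> i) = (\<Prod>i\<in>Basis. 2 * ((b - a) \<bullet> i))"
      by (intro prod.cong refl) (simp only: inner_diff_left, simp)
    also have "\<dots> = 2 ^ CARD('n) * (\<Prod>i\<in>Basis. (b - a) \<bullet> i)" by (simp add: prod.distrib)
    also have "(\<Prod>i\<in>Basis. (b - a) \<bullet> i) = m"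
      using * by (simp add: m_def Q_def measure_lborel_box_eq less_imp_le)
    finally show ?thesis .
  qed
  have shift: "(\<integral>\<^sup>+x. ennreal (\<bar>w (x + z) - w x\<bar> powr p * indicator Q x * indicator Q (x + z)) \<partial>lborel)
      \<le> (\<integral>\<^sup>+x. ennreal (H x) \<partial>lborel) * indicator D z" for z
  proof (cases "z \<in> D")
    case False
    have "\<not> (x \<in> Q \<and> x + z \<in> Q)" for x
    proof
      assume x: "x \<in> Q \<and> x + z \<in> Q"
      have "a $ i - b $ i < z $ i \<and> z $ i < b $ i - a $ i" for i
      proof -
        have "a $ i < x $ i \<and> x $ i < b $ i" "a $ i < x $ i + z $ i \<and> x $ i + z $ i < b $ i"
          using x by (auto simp: Q_def mem_box_cart)
        then show ?thesis by linarith
      qed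
      with False show False by (simp add: D_def mem_box_cart)
    qed
    then have "\<bar>w (x + z) - w x\<bar> powr p * indicator Q x * indicator Q (x + z) = 0" for x
      by (auto simp: indicator_def)
    then show ?thesis by (simp only: ennreal_0) simp
  next
    case True
    have z: "\<bar>z $ i\<bar> \<le> b $ i - a $ i" for i
    proof -
      have "a $ i - b $ i < z $ i \<and> z $ i < b $ i - a $ i" using True by (simp add: D_def mem_box_cart)
      then show ?thesis by linarith
    qed
    have ptw: "\<bar>\<Sum>i\<in>UNIV. z $ i * g i y\<bar> powr p \<le> H y" for y
    proof -
      have "\<bar>\<Sum>i\<in>UNIV. z $ i * g i y\<bar> powr p \<le> real CARD('n) powr p * (\<Sum>i\<in>UNIV. \<bar>z $ i * g i y\<bar> powr p)"
        by (rule abs_sum_powr_le[OF p])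
      also have "\<dots> \<le> H y"
        unfolding H_def abs_mult powr_mult
        by (intro mult_left_mono sum_mono mult_right_mono powr_mono2) (use p z in auto)
      finally show ?thesis .
    qed
    have "AE x in lborel. x \<in> Q \<and> x + z \<in> Q \<longrightarrow>
        w (x + z) - w x = (\<integral>s. (\<Sum>i\<in>UNIV. z $ i * g i (x + s *\<^sub>R z)) * indicator {0..1} s \<partial>lborel)"
      unfolding Q_def by (rule weak_gradient_difference[OF open_box convex_box(2) w g]) (rule parts)
    then have "AE x in lborel. ennreal (\<bar>w (x + z) - w x\<bar> powr p * indicator Q x * indicator Q (x + z))
        \<le> (\<integral>\<^sup>+s. ennreal (H (x + s *\<^sub>R z)) * indicator {0..1} s \<partial>lborel)"
    proof eventually_elim
      case (elim x)
      show ?case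
      proof (cases "x \<in> Q \<and> x + z \<in> Q")
        case True
        with elim have "ennreal (\<bar>w (x + z) - w x\<bar> powr p * indicator Q x * indicator Q (x + z))
          = ennreal (\<bar>\<integral>s. (\<Sum>i\<in>UNIV. z $ i * g i (x + s *\<^sub>R z)) * (indicator {0..1} s / 1) \<partial>lborel\<bar> powr p)"
          by simp
        also have "\<dots> \<le> (\<integral>\<^sup>+s. ennreal (\<bar>\<Sum>i\<in>UNIV. z $ i * g i (x + s *\<^sub>R z)\<bar> powr p * (indicator {0..1} s / 1)) \<partial>lborel)"
          by (rule jensen_powr_set[OF p]) auto
        also have "\<dots> \<le> (\<integral>\<^sup>+s. ennreal (H (x + s *\<^sub>R z)) * indicator {0..1} s \<partial>lborel)"
          by (intro nn_integral_mono) (auto simp: indicator_def intro!: ennreal_leI ptw)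
        finally show ?thesis .
      qed (auto simp: indicator_def)
    qed
    then have "(\<integral>\<^sup>+x. ennreal (\<bar>w (x + z) - w x\<bar> powr p * indicator Q x * indicator Q (x + z)) \<partial>lborel)
      \<le> (\<integral>\<^sup>+x. (\<integral>\<^sup>+s. ennreal (H (x + s *\<^sub>R z)) * indicator {0..1} s \<partial>lborel) \<partial>lborel)"
      by (rule nn_integral_mono_AE)
    also have "\<dots> = (\<integral>\<^sup>+s. (\<integral>\<^sup>+x. ennreal (H (x + s *\<^sub>R z)) * indicator {0..1} s \<partial>lborel) \<partial>lborel)"
      by (rule lborel_pair.Fubini') measurable
    also have "\<dots> = (\<integral>\<^sup>+s. (\<integral>\<^sup>+x. ennreal (H x) \<partial>lborel) * indicator {0..1::real} s \<partial>lborel)"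
      by (intro nn_integral_cong) (simp add: nn_integral_multc nn_integral_translate[of "\<lambda>x. ennreal (H x)"])
    also have "\<dots> = (\<integral>\<^sup>+x. ennreal (H x) \<partial>lborel)" by (simp add: nn_integral_cmult)
    finally show ?thesis using True by simp
  qed
  have avg: "ennreal (\<bar>w y\<bar> powr p) \<le> ennreal (1 / m) *
      (\<integral>\<^sup>+x. ennreal (\<bar>w y - w x\<bar> powr p * indicator Q x * indicator Q y) \<partial>lborel)" for y
  proof (cases "y \<in> Q")
    case True
    have iQ: "integrable lborel (\<lambda>x. indicator Q x :: real)" using em by (simp add: integrable_indicator_iff)
    \<comment> \<open>The vanishing mean of \<open>w\<close> is used here.\<close>
    have "(\<integral>x. (w y - w x) * (indicator Q x / m) \<partial>lborel) = (\<integral>x. (w y / m) * indicator Q x - w x / m \<partial>lborel)"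
      by (intro Bochner_Integration.integral_cong refl)
         (use w0 m in \<open>auto simp: indicator_def field_simps Q_def\<close>)
    also have "\<dots> = w y"
      using w iQ mean m by (simp add: em m_def[symmetric])
    finally have "ennreal (\<bar>w y\<bar> powr p) = ennreal (\<bar>\<integral>x. (w y - w x) * (indicator Q x / m) \<partial>lborel\<bar> powr p)"
      by simp
    also have "\<dots> \<le> (\<integral>\<^sup>+x. ennreal (\<bar>w y - w x\<bar> powr p * (indicator Q x / m)) \<partial>lborel)"
      by (rule jensen_powr_set[OF p _ _ em m]) auto
    also have "\<dots> = (\<integral>\<^sup>+x. ennreal (1 / m) * ennreal (\<bar>w y - w x\<bar> powr p * indicator Q x * indicator Q y) \<partial>lborel)"
      using m True by (intro nn_integral_cong) (simp add: ennreal_mult[symmetric])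
    also have "\<dots> = ennreal (1 / m) * (\<integral>\<^sup>+x. ennreal (\<bar>w y - w x\<bar> powr p * indicator Q x * indicator Q y) \<partial>lborel)"
      by (rule nn_integral_cmult) measurable
    finally show ?thesis .
  qed (use w0 p in \<open>auto simp: Q_def\<close>)
  have "(\<integral>\<^sup>+y. ennreal (\<bar>w y\<bar> powr p) \<partial>lborel) \<le> (\<integral>\<^sup>+y. ennreal (1 / m) *
      (\<integral>\<^sup>+x. ennreal (\<bar>w y - w x\<bar> powr p * indicator Q x * indicator Q y) \<partial>lborel) \<partial>lborel)"
    by (intro nn_integral_mono avg)
  also have "\<dots> = ennreal (1 / m) *
      (\<integral>\<^sup>+y. \<integral>\<^sup>+x. ennreal (\<bar>w y - w x\<bar> powr p * indicator Q x * indicator Q y) \<partial>lborel \<partial>lborel)"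
    by (rule nn_integral_cmult) measurable
  also have "(\<integral>\<^sup>+y. \<integral>\<^sup>+x. ennreal (\<bar>w y - w x\<bar> powr p * indicator Q x * indicator Q y) \<partial>lborel \<partial>lborel)
      = (\<integral>\<^sup>+x. \<integral>\<^sup>+y. ennreal (\<bar>w y - w x\<bar> powr p * indicator Q x * indicator Q y) \<partial>lborel \<partial>lborel)"
    by (rule lborel_pair.Fubini') measurable
  also have "\<dots> = (\<integral>\<^sup>+x. \<integral>\<^sup>+z. ennreal (\<bar>w (z + x) - w x\<bar> powr p * indicator Q x * indicator Q (z + x)) \<partial>lborel \<partial>lborel)"
    by (intro nn_integral_cong nn_integral_translate[symmetric]) measurable
  also have "\<dots> = (\<integral>\<^sup>+z. \<integral>\<^sup>+x. ennreal (\<bar>w (z + x) - w x\<bar> powr p * indicator Q x * indicator Q (z + x)) \<partial>lborel \<partial>lborel)"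
    by (rule lborel_pair.Fubini') measurable
  also have "\<dots> \<le> (\<integral>\<^sup>+z. (\<integral>\<^sup>+x. ennreal (H x) \<partial>lborel) * indicator D z \<partial>lborel)"
    using shift by (intro nn_integral_mono) (simp add: add.commute)
  also have "\<dots> = (\<integral>\<^sup>+x. ennreal (H x) \<partial>lborel) * ennreal (2 ^ CARD('n) * m)"
    by (simp add: nn_integral_cmult eD)
  finally have "(\<integral>\<^sup>+y. ennreal (\<bar>w y\<bar> powr p) \<partial>lborel) \<le>
      ennreal (1 / m) * ((\<integral>\<^sup>+x. ennreal (H x) \<partial>lborel) * ennreal (2 ^ CARD('n) * m))"
    by (simp add: mult_left_mono)
  also have "\<dots> = (ennreal (1 / m) * ennreal (2 ^ CARD('n) * m)) * (\<integral>\<^sup>+x. ennreal (H x) \<partial>lborel)"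
    by (simp add: mult_ac)
  also have "ennreal (1 / m) * ennreal (2 ^ CARD('n) * m) = ennreal (2 ^ CARD('n))"
    using m by (simp add: ennreal_mult[symmetric])
  finally show ?thesis by (simp add: H_def)
qed

text \<open>The Borel version, carried over to Lebesgue measurable functions by means of Borel representatives.\<close>

lemma poincare_box:
  fixes w :: "real^'n::finite \<Rightarrow> real" and g :: "'n \<Rightarrow> real^'n \<Rightarrow> real"
  assumes p: "1 \<le> p" and ne: "box a b \<noteq> {}"
    and w: "w \<in> Lp_space p (box a b)" and g: "\<And>i. g i \<in> Lp_space p (box a b)"
    and mean: "(LINT x:box a b|lebesgue. w x) = 0"
    and parts: "\<And>i \<phi>. \<phi> \<in> test_functions (box a b) \<Longrightarrow>
      (LINT x:box a b|lebesgue. w x * partial_deriv i \<phi> x) = - (LINT x:box a b|lebesgue. g i x * \<phi> x)"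
  shows "(LINT x:box a b|lebesgue. \<bar>w x\<bar> powr p) \<le> 2 ^ CARD('n) * real CARD('n) powr p *
     (\<Sum>i\<in>UNIV. (b $ i - a $ i) powr p * (LINT x:box a b|lebesgue. \<bar>g i x\<bar> powr p))"
proof -
  let ?Q = "box a b"
  have Qb: "?Q \<in> sets borel" "?Q \<in> sets lebesgue" "bounded ?Q" by auto
  obtain w' where w': "w' \<in> borel_measurable borel" "\<And>x. x \<notin> ?Q \<Longrightarrow> w' x = 0"
    "AE x in lebesgue. indicator ?Q x * w x = w' x"
    using borel_representative[OF w Qb(1)] by metis
  have "\<forall>i. \<exists>h. h \<in> borel_measurable borel \<and> (\<forall>x. x \<notin> ?Q \<longrightarrow> h x = 0) \<and>
     (AE x in lebesgue. indicator ?Q x * g i x = h x)"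
    using borel_representative[OF g Qb(1)] by metis
  then obtain g' where g': "\<And>i. g' i \<in> borel_measurable borel" "\<And>i x. x \<notin> ?Q \<Longrightarrow> g' i x = 0"
    "\<And>i. AE x in lebesgue. indicator ?Q x * g i x = g' i x"
    by metis
  have [measurable]: "w' \<in> borel_measurable borel" "g' i \<in> borel_measurable borel" for i
    using w' g' by auto
  \<comment> \<open>Everything the Borel version speaks about has the same value for a function and its representative.\<close>
  have trans: "integrable lborel h' \<and> integrable lborel (\<lambda>x. \<bar>h' x\<bar> powr p) \<and>
      (LINT x:?Q|lebesgue. \<bar>h x\<bar> powr p) = (\<integral>x. \<bar>h' x\<bar> powr p \<partial>lborel) \<and>
      (\<forall>\<psi>\<in>borel_measurable borel. (LINT x:?Q|lebesgue. h x * \<psi> x) = (\<integral>x. h' x * \<psi> x \<partial>lborel))"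
    if h: "h \<in> Lp_space p ?Q" and [measurable]: "h' \<in> borel_measurable borel"
      and ae: "AE x in lebesgue. indicator ?Q x * h x = h' x" for h h'
  proof (intro conjI ballI)
    have "integrable lebesgue (\<lambda>x. indicator ?Q x * h x)"
      using Lp_space_integrable[OF p h Qb(2,3)] by (simp add: set_integrable_def)
    with lebesgue_integrable_cong_AE[OF ae] have "integrable lebesgue h'" by simp
    then show "integrable lborel h'" by (subst (asm) integrable_completion) auto
    have ae2: "AE x in lebesgue. indicator ?Q x * \<bar>h x\<bar> powr p = \<bar>h' x\<bar> powr p"
      using ae by eventually_elim (use p in \<open>auto simp: indicator_def split: if_splits\<close>)
    have "integrable lebesgue (\<lambda>x. \<bar>h' x\<bar> powr p)"
      using lebesgue_integrable_cong_AE[OF ae2] h by (simp add: Lp_space_iff)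
    then show "integrable lborel (\<lambda>x. \<bar>h' x\<bar> powr p)" by (subst (asm) integrable_completion) auto
    have "(LINT x:?Q|lebesgue. \<bar>h x\<bar> powr p) = (\<integral>x. \<bar>h' x\<bar> powr p \<partial>lebesgue)"
      unfolding set_lebesgue_integral_def using lebesgue_integral_cong_AE[OF ae2] by simp
    also have "\<dots> = (\<integral>x. \<bar>h' x\<bar> powr p \<partial>lborel)" by (rule integral_completion) simp
    finally show "(LINT x:?Q|lebesgue. \<bar>h x\<bar> powr p) = (\<integral>x. \<bar>h' x\<bar> powr p \<partial>lborel)" .
    fix \<psi> :: "real^'n \<Rightarrow> real" assume [measurable]: "\<psi> \<in> borel_measurable borel"
    have ae3: "AE x in lebesgue. indicator ?Q x * (h x * \<psi> x) = h' x * \<psi> x"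
      using ae by eventually_elim (auto simp: indicator_def)
    have "(LINT x:?Q|lebesgue. h x * \<psi> x) = (\<integral>x. h' x * \<psi> x \<partial>lebesgue)"
      unfolding set_lebesgue_integral_def using lebesgue_integral_cong_AE[OF ae3] by simp
    also have "\<dots> = (\<integral>x. h' x * \<psi> x \<partial>lborel)" by (rule integral_completion) simp
    finally show "(LINT x:?Q|lebesgue. h x * \<psi> x) = (\<integral>x. h' x * \<psi> x \<partial>lborel)" .
  qed
  note tw = trans[OF w w'(1,3)] and tg = trans[OF g g'(1,3)]
  have iG: "integrable lborel (\<lambda>x. real CARD('n) powr p * (\<Sum>i\<in>UNIV. (b $ i - a $ i) powr p * \<bar>g' i x\<bar> powr p))"
    using tg by auto
  have "(\<integral>\<^sup>+x. ennreal (\<bar>w' x\<bar> powr p) \<partial>lborel) \<le> ennreal (2 ^ CARD('n)) *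
     (\<integral>\<^sup>+x. ennreal (real CARD('n) powr p * (\<Sum>i\<in>UNIV. (b $ i - a $ i) powr p * \<bar>g' i x\<bar> powr p)) \<partial>lborel)"
  proof (rule poincare_box_borel[OF p ne _ _ w'(2)])
    show "(\<integral>x. w' x \<partial>lborel) = 0"
      using tw mean by (auto dest!: bspec[where x = "\<lambda>_. 1"])
    fix i \<phi> assume \<phi>: "\<phi> \<in> test_functions (box a b)"
    have "\<phi> \<in> borel_measurable borel" "partial_deriv i \<phi> \<in> borel_measurable borel"
      using smooth_test[OF \<phi>] by (auto intro!: borel_measurable_smooth smooth_partial_deriv)
    with parts[OF \<phi>, of i] tw tg[of i]
    show "(\<integral>x. w' x * partial_deriv i \<phi> x \<partial>lborel) = - (\<integral>x. g' i x * \<phi> x \<partial>lborel)" by simp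
  qed (use tw tg in auto)
  also have "(\<integral>\<^sup>+x. ennreal (\<bar>w' x\<bar> powr p) \<partial>lborel) = ennreal (\<integral>x. \<bar>w' x\<bar> powr p \<partial>lborel)"
    using tw by (intro nn_integral_eq_integral) auto
  also have "(\<integral>\<^sup>+x. ennreal (real CARD('n) powr p * (\<Sum>i\<in>UNIV. (b $ i - a $ i) powr p * \<bar>g' i x\<bar> powr p)) \<partial>lborel)
      = ennreal (\<integral>x. real CARD('n) powr p * (\<Sum>i\<in>UNIV. (b $ i - a $ i) powr p * \<bar>g' i x\<bar> powr p) \<partial>lborel)"
    using iG by (intro nn_integral_eq_integral) (auto intro!: AE_I2 mult_nonneg_nonneg sum_nonneg)
  also have "ennreal (2 ^ CARD('n)) * \<dots> = ennreal (2 ^ CARD('n) *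
      (\<integral>x. real CARD('n) powr p * (\<Sum>i\<in>UNIV. (b $ i - a $ i) powr p * \<bar>g' i x\<bar> powr p) \<partial>lborel))"
    by (simp add: ennreal_mult')
  finally have "(\<integral>x. \<bar>w' x\<bar> powr p \<partial>lborel) \<le> 2 ^ CARD('n) *
      (\<integral>x. real CARD('n) powr p * (\<Sum>i\<in>UNIV. (b $ i - a $ i) powr p * \<bar>g' i x\<bar> powr p) \<partial>lborel)"
    by (subst (asm) ennreal_le_iff)
       (auto intro!: mult_nonneg_nonneg Bochner_Integration.integral_nonneg sum_nonneg)
  also have "(\<integral>x. real CARD('n) powr p * (\<Sum>i\<in>UNIV. (b $ i - a $ i) powr p * \<bar>g' i x\<bar> powr p) \<partial>lborel)
      = real CARD('n) powr p * (\<Sum>i\<in>UNIV. (b $ i - a $ i) powr p * (\<integral>x. \<bar>g' i x\<bar> powr p \<partial>lborel))"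
    using tg by (simp add: Bochner_Integration.integral_sum)
  finally show ?thesis using tw tg by (simp add: mult.assoc)
qed

section \<open>Polynomials with prescribed moments\<close>

definition vec_monomial :: "('n::finite \<Rightarrow> nat) \<Rightarrow> real^'n \<Rightarrow> real" where
  "vec_monomial \<alpha> x = (\<Prod>i\<in>UNIV. x $ i ^ \<alpha> i)"

lemma smooth_vec_monomial: "smooth (vec_monomial \<alpha>)"
  unfolding vec_monomial_def[abs_def] by (intro smooth_prod smooth_power smooth_nth)

lemma partial_deriv_sum_scaled:
  assumes "\<And>a. a \<in> A \<Longrightarrow> smooth (f a)"
  shows "partial_deriv i (\<lambda>x. \<Sum>a\<in>A. c a * f a x) = (\<lambda>x. \<Sum>a\<in>A. c a * partial_deriv i (f a) x)"
proof
  fix x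
  have "((\<lambda>x. \<Sum>a\<in>A. c a * f a x) has_derivative
      (\<lambda>v. \<Sum>a\<in>A. c a * (\<Sum>j\<in>UNIV. v $ j * partial_deriv j (f a) x))) (at x)"
    by (intro has_derivative_sum has_derivative_mult_right has_derivative_partial_deriv
        smooth_imp_differentiable assms)
  from partial_deriv_eqI[OF this, of i]
  show "partial_deriv i (\<lambda>x. \<Sum>a\<in>A. c a * f a x) x = (\<Sum>a\<in>A. c a * partial_deriv i (f a) x)"
    by (simp add: axis_def if_distrib[of "\<lambda>x. x * _"] cong: if_cong)
qed

lemma multi_partial_sum_scaled:
  assumes f: "\<And>a. a \<in> A \<Longrightarrow> smooth (f a)"
  shows "multi_partial \<beta> (\<lambda>x. \<Sum>a\<in>A. c a * f a x) = (\<lambda>x. \<Sum>a\<in>A. c a * multi_partial \<beta> (f a) x)"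
proof -
  have "foldr partial_deriv l (\<lambda>x. \<Sum>a\<in>A. c a * f a x) = (\<lambda>x. \<Sum>a\<in>A. c a * foldr partial_deriv l (f a) x)" for l
    by (induction l) (simp_all add: partial_deriv_sum_scaled smooth_foldr_partial_deriv f)
  then show ?thesis by (simp add: multi_partial_def)
qed

lemma partial_deriv_vec_monomial:
  "partial_deriv i (\<lambda>x. c * vec_monomial \<alpha> x) = (\<lambda>x. (c * \<alpha> i) * vec_monomial (\<lambda>j. \<alpha> j - mi_unit i j) x)"
proof
  fix x :: "real^'a"
  let ?R = "\<Prod>j\<in>UNIV - {i}. x $ j ^ \<alpha> j"
  have "vec_monomial \<alpha> (x + t *\<^sub>R axis i 1) = (x $ i + t) ^ \<alpha> i * ?R" for t
    unfolding vec_monomial_def by (subst prod.remove[of _ i]) (auto simp: axis_def intro!: prod.cong)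
  then have "partial_deriv i (\<lambda>x. c * vec_monomial \<alpha> x) x = deriv (\<lambda>t. c * ((x $ i + t) ^ \<alpha> i * ?R)) 0"
    by (simp add: partial_deriv_def)
  also have "\<dots> = c * (real (\<alpha> i) * (x $ i) ^ (\<alpha> i - 1) * ?R)"
    by (rule DERIV_imp_deriv) (auto intro!: derivative_eq_intros)
  also have "vec_monomial (\<lambda>j. \<alpha> j - mi_unit i j) x = (x $ i) ^ (\<alpha> i - 1) * ?R"
    unfolding vec_monomial_def by (subst prod.remove[of _ i]) (auto simp: mi_unit_def intro!: prod.cong)
  then have "c * (real (\<alpha> i) * (x $ i) ^ (\<alpha> i - 1) * ?R) = (c * \<alpha> i) * vec_monomial (\<lambda>j. \<alpha> j - mi_unit i j) x"
    by simp
  finally show "partial_deriv i (\<lambda>x. c * vec_monomial \<alpha> x) x = (c * \<alpha> i) * vec_monomial (\<lambda>j. \<alpha> j - mi_unit i j) x" .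
qed

lemma multi_partial_vec_monomial:
  "\<exists>c. multi_partial \<beta> (vec_monomial \<alpha>) = (\<lambda>x. c * vec_monomial (\<lambda>j. \<alpha> j - \<beta> j) x) \<and>
       (c \<noteq> 0 \<longleftrightarrow> (\<forall>i. \<beta> i \<le> \<alpha> i))"
proof -
  obtain l where l: "\<And>i. count_list l i = \<beta> i" using ex_list_count[of \<beta>] by auto
  have "\<exists>c. foldr partial_deriv l (vec_monomial \<alpha>) = (\<lambda>x. c * vec_monomial (\<lambda>j. \<alpha> j - count_list l j) x) \<and>
       (c \<noteq> 0 \<longleftrightarrow> (\<forall>i. count_list l i \<le> \<alpha> i))"
  proof (induction l)
    case Nil
    show ?case by (rule exI[of _ 1]) auto
  next
    case (Cons i l)
    then obtain c where c: "foldr partial_deriv l (vec_monomial \<alpha>) = (\<lambda>x. c * vec_monomial (\<lambda>j. \<alpha> j - count_list l j) x)"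
      "c \<noteq> 0 \<longleftrightarrow> (\<forall>i. count_list l i \<le> \<alpha> i)" by blast
    have "(\<lambda>j. \<alpha> j - count_list l j - mi_unit i j) = (\<lambda>j. \<alpha> j - count_list (i # l) j)"
      by (auto simp: mi_unit_def fun_eq_iff)
    with c(1) have "foldr partial_deriv (i # l) (vec_monomial \<alpha>)
      = (\<lambda>x. (c * real (\<alpha> i - count_list l i)) * vec_monomial (\<lambda>j. \<alpha> j - count_list (i # l) j) x)"
      by (simp add: partial_deriv_vec_monomial)
    moreover have "c * real (\<alpha> i - count_list l i) \<noteq> 0 \<longleftrightarrow> (\<forall>j. count_list (i # l) j \<le> \<alpha> j)"
    proof -
      have "c * real (\<alpha> i - count_list l i) \<noteq> 0 \<longleftrightarrow> (\<forall>j. count_list l j \<le> \<alpha> j) \<and> count_list l i < \<alpha> i"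
        using c(2) by auto
      also have "\<dots> \<longleftrightarrow> (\<forall>j. count_list (i # l) j \<le> \<alpha> j)"
      proof (intro iffI conjI allI)
        fix j assume A: "\<forall>j. count_list (i # l) j \<le> \<alpha> j"
        from A[rule_format, of j] show "count_list l j \<le> \<alpha> j" by (simp split: if_splits)
        from A[rule_format, of i] show "count_list l i < \<alpha> i" by simp
      qed auto
      finally show ?thesis .
    qed
    ultimately show ?case by blast
  qed
  then show ?thesis by (simp add: l multi_partial_eq_foldr[OF smooth_vec_monomial l])
qed

text \<open>Among multi-indices of at least the same order, only \<open>\<beta> = \<alpha>\<close> can be dominated componentwise by \<open>\<alpha>\<close>.
This is what makes the system of moment conditions triangular, and also what annihilates the
derivatives of the approximating polynomial whose order appears on the right of the estimate.\<close>

lemma multi_partial_vec_monomial_eq_0: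
  assumes "mi_abs \<alpha> \<le> mi_abs \<beta>" "\<alpha> \<noteq> \<beta>"
  shows "multi_partial \<beta> (vec_monomial \<alpha>) = (\<lambda>_. 0)"
proof -
  have "\<not> (\<forall>i. \<beta> i \<le> \<alpha> i)"
  proof
    assume le: "\<forall>i. \<beta> i \<le> \<alpha> i"
    obtain j where "\<alpha> j \<noteq> \<beta> j" using assms(2) by auto
    with le have "\<beta> j < \<alpha> j" by (simp add: le_neq_implies_less)
    with le have "mi_abs \<beta> < mi_abs \<alpha>" unfolding mi_abs_def by (intro sum_strict_mono_ex1) auto
    with assms(1) show False by simp
  qed
  with multi_partial_vec_monomial[of \<beta> \<alpha>] show ?thesis by auto
qed

lemma multi_partial_vec_monomial_self:
  "\<exists>c\<noteq>0. multi_partial \<alpha> (vec_monomial \<alpha>) = (\<lambda>_. c)"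
  using multi_partial_vec_monomial[of \<alpha> \<alpha>] by (auto simp: vec_monomial_def)

text \<open>Induction that adds an index of smallest rank: its coefficient does not enter the equations of the
other indices, so it can be fixed last by its own equation.\<close>

lemma triangular_system_solvable:
  fixes L :: "'b \<Rightarrow> 'b \<Rightarrow> real" and rank :: "'b \<Rightarrow> nat"
  assumes "finite J"
    and "\<And>\<beta>. \<beta> \<in> J \<Longrightarrow> L \<beta> \<beta> \<noteq> 0"
    and "\<And>\<alpha> \<beta>. \<alpha> \<in> J \<Longrightarrow> \<beta> \<in> J \<Longrightarrow> \<alpha> \<noteq> \<beta> \<Longrightarrow> rank \<alpha> \<le> rank \<beta> \<Longrightarrow> L \<beta> \<alpha> = 0"
  shows "\<exists>c. \<forall>\<beta>\<in>J. (\<Sum>\<alpha>\<in>J. c \<alpha> * L \<beta> \<alpha>) = t \<beta>"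
  using assms
proof (induction J rule: finite_ranking_induct[where f = "\<lambda>x. - int (rank x)"])
  case (insert x J)
  have "\<exists>c. \<forall>\<beta>\<in>J. (\<Sum>\<alpha>\<in>J. c \<alpha> * L \<beta> \<alpha>) = t \<beta>"
    by (rule insert.IH) (use insert.prems in auto)
  then obtain c where c: "\<forall>\<beta>\<in>J. (\<Sum>\<alpha>\<in>J. c \<alpha> * L \<beta> \<alpha>) = t \<beta>" by blast
  show ?case
  proof (cases "x \<in> J")
    case True
    with c show ?thesis by (auto simp: insert_absorb)
  next
    case False
    define c' where "c' = c(x := (t x - (\<Sum>\<alpha>\<in>J. c \<alpha> * L x \<alpha>)) / L x x)"
    have *: "(\<Sum>\<alpha>\<in>J. c' \<alpha> * L \<beta> \<alpha>) = (\<Sum>\<alpha>\<in>J. c \<alpha> * L \<beta> \<alpha>)" for \<beta>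
      using False by (intro sum.cong) (auto simp: c'_def)
    have "(\<Sum>\<alpha>\<in>insert x J. c' \<alpha> * L \<beta> \<alpha>) = t \<beta>" if \<beta>: "\<beta> \<in> insert x J" for \<beta>
    proof (cases "\<beta> = x")
      case True
      have "L x x \<noteq> 0" using insert.prems by auto
      then show ?thesis using True False insert.hyps by (simp add: * ) (simp add: c'_def)
    next
      case neq: False
      then have "\<beta> \<in> J" using \<beta> by auto
      moreover have "L \<beta> x = 0"
        using insert.hyps(2)[OF \<open>\<beta> \<in> J\<close>] neq \<open>\<beta> \<in> J\<close> by (intro insert.prems(2)) auto
      ultimately show ?thesis using c False insert.hyps by (simp add: * )
    qed
    then show ?thesis by blast
  qed
qed simp

text \<open>The moments of the derivatives form a triangular system when the multi-indices are ordered by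
\<^const>\<open>mi_abs\<close>, with the non-zero factorials times the volume of the box on the diagonal.\<close>

lemma polynomial_with_moments:
  fixes t :: "('n::finite \<Rightarrow> nat) \<Rightarrow> real"
  assumes J: "finite J" and ne: "box a b \<noteq> ({} :: (real^'n) set)"
  shows "\<exists>c. \<forall>\<beta>\<in>J. (LINT x:box a b|lebesgue. multi_partial \<beta> (\<lambda>x. \<Sum>\<alpha>\<in>J. c \<alpha> * vec_monomial \<alpha> x) x) = t \<beta>"
proof -
  define L where "L \<beta> \<alpha> = (LINT x:box a b|lebesgue. multi_partial \<beta> (vec_monomial \<alpha>) x)" for \<beta> \<alpha>
  have m: "measure lebesgue (box a b) > 0"
    using ne by (simp add: measure_lborel_box_eq box_ne_empty prod_pos less_imp_le inner_diff_left)
  have "\<exists>c. \<forall>\<beta>\<in>J. (\<Sum>\<alpha>\<in>J. c \<alpha> * L \<beta> \<alpha>) = t \<beta>"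
  proof (rule triangular_system_solvable[OF J, where rank = mi_abs])
    show "L \<beta> \<beta> \<noteq> 0" for \<beta>
    proof -
      obtain c where "c \<noteq> 0" "multi_partial \<beta> (vec_monomial \<beta>) = (\<lambda>_::real^'n. c)"
        using multi_partial_vec_monomial_self[of \<beta>] by blast
      with m show ?thesis by (simp add: L_def set_lebesgue_integral_def)
    qed
    show "L \<beta> \<alpha> = 0" if "\<alpha> \<noteq> \<beta>" "mi_abs \<alpha> \<le> mi_abs \<beta>" for \<alpha> \<beta>
      unfolding L_def using multi_partial_vec_monomial_eq_0[OF that(2,1)]
      by (simp add: set_lebesgue_integral_def)
  qed
  moreover have "(LINT x:box a b|lebesgue. multi_partial \<beta> (\<lambda>x. \<Sum>\<alpha>\<in>J. c \<alpha> * vec_monomial \<alpha> x) x)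
      = (\<Sum>\<alpha>\<in>J. c \<alpha> * L \<beta> \<alpha>)" for c \<beta>
  proof -
    have "set_integrable lebesgue (box a b) (multi_partial \<beta> (vec_monomial \<alpha>))" for \<alpha> :: "'n \<Rightarrow> nat"
    proof -
      have "locally_integrable UNIV (multi_partial \<beta> (vec_monomial \<alpha>) :: real^'n \<Rightarrow> real)"
        by (intro locally_integrable_continuous smooth_imp_continuous_on smooth_multi_partial smooth_vec_monomial)
      then have "set_integrable lebesgue (cbox a b) (multi_partial \<beta> (vec_monomial \<alpha>))"
        by (auto simp: locally_integrable_def)
      then show ?thesis by (rule set_integrable_subset) (auto simp: box_subset_cbox)
    qed
    then have "integrable lebesgue (\<lambda>x. indicator (box a b) x * multi_partial \<beta> (vec_monomial \<alpha>) x)" for \<alpha> :: "'n \<Rightarrow> nat"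
      by (simp add: set_integrable_def)
    then show ?thesis
      unfolding multi_partial_sum_scaled[OF smooth_vec_monomial] L_def set_lebesgue_integral_def
      by (simp add: sum_distrib_left mult.left_commute[of "indicator _ _"] Bochner_Integration.integral_sum)
  qed
  ultimately show ?thesis by simp
qed

section \<open>The estimate on one element\<close>

lemma finite_Ind: "finite (Ind k :: ('n::finite \<Rightarrow> nat) set)"
proof (rule finite_subset)
  show "Ind k \<subseteq> (UNIV \<rightarrow>\<^sub>E {..k} :: ('n \<Rightarrow> nat) set)"
  proof
    fix \<alpha> :: "'n \<Rightarrow> nat" assume "\<alpha> \<in> Ind k"
    then have "mi_abs \<alpha> \<le> k" by (simp add: Ind_def)
    moreover have "\<alpha> i \<le> mi_abs \<alpha>" for i unfolding mi_abs_def by (rule member_le_sum) auto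
    ultimately show "\<alpha> \<in> UNIV \<rightarrow>\<^sub>E {..k}" by (auto intro: order_trans)
  qed
qed (auto intro: finite_PiE)

text \<open>One application of the Poincare inequality in direction \<open>i\<close> produces exactly the power of the mesh size
by which the weights of \<open>\<alpha>\<close> and \<open>\<alpha> + e\<^sub>i\<close> differ.\<close>

lemma weight_add_unit:
  fixes h :: "'n::finite \<Rightarrow> real"
  assumes h: "\<And>i. 0 < h i"
  shows "h i powr p * (\<Prod>j\<in>UNIV. h j powr (p * (real (\<gamma> j) - real (\<alpha> j + mi_unit i j))))
       = (\<Prod>j\<in>UNIV. h j powr (p * (real (\<gamma> j) - real (\<alpha> j))))"
proof -
  have "h i powr p = (\<Prod>j\<in>UNIV. h j powr (p * real (mi_unit i j)))"
    by (subst prod.remove[of _ i]) (auto simp: mi_unit_def h less_imp_neq[THEN not_sym])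
  then show ?thesis
    by (simp add: prod.distrib[symmetric] powr_add[symmetric] algebra_simps)
qed

text \<open>The polynomial is chosen so that all derivatives of order \<open>\<alpha> \<in> J\<close> of the error have mean zero. The Poincare
inequality then trades the derivative of order \<open>\<alpha>\<close> for those of order \<open>\<alpha> + e\<^sub>i\<close>. This is repeated until an
index in \<open>\<Gamma>\<close> is reached; there the polynomial has vanishing derivative and the error is the derivative of
\<^term>\<open>u\<close> itself. At most \<open>r + 1\<close> steps occur, each costing a factor \<open>M\<close>.\<close>

lemma element_estimate:
  fixes u :: "real^'n::finite \<Rightarrow> real" and D :: "('n \<Rightarrow> nat) \<Rightarrow> real^'n \<Rightarrow> real"
  assumes p: "1 \<le> p" and ne: "box a b \<noteq> {}"
    and deriv: "\<And>\<gamma>. \<gamma> \<in> Ind (Suc r) \<Longrightarrow> has_weak_deriv (box a b) \<gamma> u (D \<gamma>)"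
    and Lp: "\<And>\<gamma>. \<gamma> \<in> Ind (Suc r) \<Longrightarrow> D \<gamma> \<in> Lp_space p (box a b)"
    and J: "J \<subseteq> Ind r" "\<Gamma> = Ind (Suc r) - J" "\<And>\<gamma>. \<gamma> \<in> \<Gamma> \<Longrightarrow> r \<le> mi_abs \<gamma>"
  defines "weight \<equiv> \<lambda>\<gamma> \<alpha>. \<Prod>i\<in>UNIV. (b $ i - a $ i) powr (p * (real (\<gamma> i) - real (\<alpha> i)))"
    and "M \<equiv> 1 + 2 ^ CARD('n) * real CARD('n) powr p * real CARD('n)"
  shows "\<exists>c. \<forall>\<alpha>\<in>Ind (Suc r).
    (LINT x:box a b|lebesgue. \<bar>D \<alpha> x - multi_partial \<alpha> (\<lambda>x. \<Sum>\<beta>\<in>J. c \<beta> * vec_monomial \<beta> x) x\<bar> powr p)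
    \<le> M ^ Suc r * (\<Sum>\<gamma>\<in>\<Gamma>. weight \<gamma> \<alpha> * (LINT x:box a b|lebesgue. \<bar>D \<gamma> x\<bar> powr p))"
proof -
  let ?Q = "box a b"
  let ?N = "\<lambda>f. LINT x:?Q|lebesgue. \<bar>f x\<bar> powr p"
  have Q: "?Q \<in> sets lebesgue" "bounded ?Q" by auto
  have h: "0 < b $ i - a $ i" for i using ne by (simp add: interval_ne_empty_cart)
  have J': "finite J" using J(1) finite_Ind finite_subset by blast
  have fin: "finite \<Gamma>" using J(2) finite_Ind by auto
  obtain c where c: "\<And>\<beta>. \<beta> \<in> J \<Longrightarrow>
      (LINT x:?Q|lebesgue. multi_partial \<beta> (\<lambda>x. \<Sum>\<alpha>\<in>J. c \<alpha> * vec_monomial \<alpha> x) x) = (LINT x:?Q|lebesgue. D \<beta> x)"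
    using polynomial_with_moments[OF J' ne, of "\<lambda>\<beta>. LINT x:?Q|lebesgue. D \<beta> x"] by blast
  define q where "q = (\<lambda>x. \<Sum>\<alpha>\<in>J. c \<alpha> * vec_monomial \<alpha> x)"
  have q: "smooth q" unfolding q_def by (intro smooth_sum smooth_scale smooth_vec_monomial)
  have cont: "continuous_on UNIV (multi_partial \<gamma> q)" for \<gamma>
    by (intro smooth_imp_continuous_on smooth_multi_partial q)
  have vanish: "multi_partial \<gamma> q = (\<lambda>_. 0)" if "\<gamma> \<in> \<Gamma>" for \<gamma>
  proof -
    have "multi_partial \<gamma> (vec_monomial \<alpha>) = (\<lambda>_::real^'n. 0)" if "\<alpha> \<in> J" for \<alpha>
      using that \<open>\<gamma> \<in> \<Gamma>\<close> J(1,2) J(3)[OF \<open>\<gamma> \<in> \<Gamma>\<close>]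
      by (intro multi_partial_vec_monomial_eq_0) (auto simp: Ind_def)
    then show ?thesis
      unfolding q_def multi_partial_sum_scaled[OF smooth_vec_monomial] by simp
  qed
  define E where "E \<gamma> x = D \<gamma> x - multi_partial \<gamma> q x" for \<gamma> x
  have E_Lp: "E \<gamma> \<in> Lp_space p ?Q" if "\<gamma> \<in> Ind (Suc r)" for \<gamma>
    unfolding E_def by (rule Lp_space_diff_continuous[OF p Lp[OF that] Q cont])
  have E_deriv: "has_weak_deriv ?Q \<gamma> (\<lambda>x. u x - q x) (E \<gamma>)" if "\<gamma> \<in> Ind (Suc r)" for \<gamma>
    unfolding E_def by (rule has_weak_deriv_diff[OF deriv[OF that] has_weak_deriv_smooth[OF q]])
  have N0: "0 \<le> ?N f" for f
    unfolding set_lebesgue_integral_def by (intro Bochner_Integration.integral_nonneg) simp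
  have W0: "0 \<le> weight \<gamma> \<alpha>" for \<gamma> \<alpha> unfolding weight_def by (intro prod_nonneg) simp
  have S0: "0 \<le> (\<Sum>\<gamma>\<in>\<Gamma>. weight \<gamma> \<alpha> * ?N (D \<gamma>))" for \<alpha>
    by (intro sum_nonneg mult_nonneg_nonneg W0 N0)
  have M1: "1 \<le> M" by (simp add: M_def)
  have direct: "?N (E \<alpha>) \<le> M ^ k * (\<Sum>\<gamma>\<in>\<Gamma>. weight \<gamma> \<alpha> * ?N (D \<gamma>))" if "\<alpha> \<in> \<Gamma>" for \<alpha> k
  proof -
    have "weight \<alpha> \<alpha> = 1" using h by (simp add: weight_def less_imp_neq[THEN not_sym])
    then have "?N (E \<alpha>) = weight \<alpha> \<alpha> * ?N (D \<alpha>)" by (simp add: E_def vanish[OF that])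
    also have "\<dots> \<le> (\<Sum>\<gamma>\<in>\<Gamma>. weight \<gamma> \<alpha> * ?N (D \<gamma>))"
      by (rule member_le_sum[OF that]) (auto intro: fin mult_nonneg_nonneg W0 N0)
    also have "\<dots> \<le> M ^ k * (\<Sum>\<gamma>\<in>\<Gamma>. weight \<gamma> \<alpha> * ?N (D \<gamma>))"
      using mult_right_mono[OF one_le_power[OF M1, of k] S0[of \<alpha>]] by simp
    finally show ?thesis .
  qed
  have main: "?N (E \<alpha>) \<le> M ^ k * (\<Sum>\<gamma>\<in>\<Gamma>. weight \<gamma> \<alpha> * ?N (D \<gamma>))"
    if "\<alpha> \<in> Ind (Suc r)" "Suc r \<le> mi_abs \<alpha> + k" for \<alpha> k
    using that
  proof (induction k arbitrary: \<alpha>)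
    case 0
    \<comment> \<open>With no step left the order of \<open>\<alpha>\<close> is \<open>r + 1\<close>, which exceeds all orders in \<open>J\<close>.\<close>
    then have "\<alpha> \<in> \<Gamma>" using J by (auto simp: Ind_def)
    then show ?case by (rule direct)
  next
    case (Suc k)
    show ?case
    proof (cases "\<alpha> \<in> \<Gamma>")
      case True
      then show ?thesis by (rule direct)
    next
      case False
      then have \<alpha>J: "\<alpha> \<in> J" using Suc.prems J(2) by auto
      define s where "s i = (\<lambda>j. \<alpha> j + mi_unit i j)" for i
      have s: "s i \<in> Ind (Suc r)" "Suc r \<le> mi_abs (s i) + k" for i
        using \<alpha>J J(1) Suc.prems by (auto simp: s_def Ind_def mi_abs_add_unit)
      have "?N (E \<alpha>) \<le> 2 ^ CARD('n) * real CARD('n) powr p * (\<Sum>i\<in>UNIV. (b $ i - a $ i) powr p * ?N (E (s i)))"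
      proof (rule poincare_box[OF p ne E_Lp[OF Suc.prems(1)] E_Lp[OF s(1)]])
        have "set_integrable lebesgue ?Q (multi_partial \<alpha> q)"
        proof (rule set_integrable_subset)
          show "set_integrable lebesgue (cbox a b) (multi_partial \<alpha> q)"
            using locally_integrable_continuous[OF cont, of UNIV \<alpha>] by (auto simp: locally_integrable_def)
        qed (auto simp: box_subset_cbox)
        then show "(LINT x:?Q|lebesgue. E \<alpha> x) = 0"
          unfolding E_def using c[OF \<alpha>J] Lp_space_integrable[OF p Lp[OF Suc.prems(1)] Q]
          by (simp add: set_integral_diff q_def)
        show "(LINT x:?Q|lebesgue. E \<alpha> x * partial_deriv i \<phi> x) = - (LINT x:?Q|lebesgue. E (s i) x * \<phi> x)"
          if "\<phi> \<in> test_functions ?Q" for i \<phi>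
          using has_weak_deriv_step[OF E_deriv[OF Suc.prems(1)] _ that] E_deriv[OF s(1)[of i]]
          unfolding s_def by blast
      qed
      also have "\<dots> \<le> 2 ^ CARD('n) * real CARD('n) powr p *
          (\<Sum>i\<in>(UNIV::'n set). M ^ k * (\<Sum>\<gamma>\<in>\<Gamma>. weight \<gamma> \<alpha> * ?N (D \<gamma>)))"
      proof (intro mult_left_mono sum_mono)
        fix i :: 'n
        have "(b $ i - a $ i) powr p * ?N (E (s i))
            \<le> (b $ i - a $ i) powr p * (M ^ k * (\<Sum>\<gamma>\<in>\<Gamma>. weight \<gamma> (s i) * ?N (D \<gamma>)))"
          by (intro mult_left_mono Suc.IH s) simp
        also have "\<dots> = M ^ k * (\<Sum>\<gamma>\<in>\<Gamma>. ((b $ i - a $ i) powr p * weight \<gamma> (s i)) * ?N (D \<gamma>))"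
          by (simp add: sum_distrib_left mult_ac)
        also have "\<dots> = M ^ k * (\<Sum>\<gamma>\<in>\<Gamma>. weight \<gamma> \<alpha> * ?N (D \<gamma>))"
          unfolding weight_def s_def using weight_add_unit[of "\<lambda>i. b $ i - a $ i", OF h] by simp
        finally show "(b $ i - a $ i) powr p * ?N (E (s i)) \<le> M ^ k * (\<Sum>\<gamma>\<in>\<Gamma>. weight \<gamma> \<alpha> * ?N (D \<gamma>))" .
      qed auto
      also have "\<dots> = (2 ^ CARD('n) * real CARD('n) powr p * real CARD('n)) * (M ^ k * (\<Sum>\<gamma>\<in>\<Gamma>. weight \<gamma> \<alpha> * ?N (D \<gamma>)))"
        by simp
      also have "\<dots> \<le> M * (M ^ k * (\<Sum>\<gamma>\<in>\<Gamma>. weight \<gamma> \<alpha> * ?N (D \<gamma>)))"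
        using M1 by (intro mult_right_mono mult_nonneg_nonneg S0) (auto simp: M_def)
      finally show ?thesis by (simp add: mult.assoc)
    qed
  qed
  show ?thesis
  proof (intro exI[of _ c] ballI)
    fix \<alpha> :: "'n \<Rightarrow> nat" assume "\<alpha> \<in> Ind (Suc r)"
    from main[OF this, of "Suc r"]
    show "(LINT x:?Q|lebesgue. \<bar>D \<alpha> x - multi_partial \<alpha> (\<lambda>x. \<Sum>\<beta>\<in>J. c \<beta> * vec_monomial \<beta> x) x\<bar> powr p)
      \<le> M ^ Suc r * (\<Sum>\<gamma>\<in>\<Gamma>. weight \<gamma> \<alpha> * ?N (D \<gamma>))"
      by (simp add: E_def q_def)
  qed
qed

section \<open>From one element to the mesh\<close>

text \<open>Elements are only known to lie in the closure of the domain, whereas the weak derivatives live on the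
domain. A Lipschitz domain has no slits: just above a boundary point, in the direction of the graph, there
are points at positive distance from the domain, so no boundary point is interior to the closure.\<close>

lemma lipschitz_boundary_interior_closure:
  fixes \<Omega> :: "(real^'n::finite) set"
  assumes "open \<Omega>" "lipschitz_boundary \<Omega>"
  shows "interior (closure \<Omega>) \<subseteq> \<Omega>"
proof (rule ccontr)
  assume "\<not> interior (closure \<Omega>) \<subseteq> \<Omega>"
  then obtain x where x: "x \<in> interior (closure \<Omega>)" "x \<notin> \<Omega>" by blast
  then have xf: "x \<in> frontier \<Omega>"
    using assms(1) interior_subset[of "closure \<Omega>"] by (simp add: frontier_def interior_open subset_iff)
  obtain e \<rho> L and \<psi> :: "real^'n \<Rightarrow> real" where e: "norm e = 1" "\<rho> > 0"
    and lip: "L-lipschitz_on {z. z \<bullet> e = 0} \<psi>"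
    and \<Omega>: "\<Omega> \<inter> ball x \<rho> = {y \<in> ball x \<rho>. y \<bullet> e < \<psi> (y - (y \<bullet> e) *\<^sub>R e)}"
    using bspec[OF assms(2)[unfolded lipschitz_boundary_def] xf]
    by (elim exE conjE) (rule that)
  define P where "P y = y - (y \<bullet> e) *\<^sub>R e" for y
  have ee: "e \<bullet> e = 1" using e(1) by (simp add: norm_eq_1)
  have Pker: "P y \<in> {z. z \<bullet> e = 0}" for y by (simp add: P_def inner_diff_left ee)
  have L0: "0 \<le> L" using lip by (rule lipschitz_on_nonneg)
  have ab: "\<bar>v \<bullet> e\<bar> \<le> norm v" for v using Cauchy_Schwarz_ineq2[of v e] e by simp
  have Plip: "dist (P y) (P z) \<le> 2 * dist y z" for y z
  proof -
    have "P y - P z = (y - z) - ((y - z) \<bullet> e) *\<^sub>R e" by (simp add: P_def inner_diff_left algebra_simps)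
    then have "norm (P y - P z) \<le> norm (y - z) + norm (((y - z) \<bullet> e) *\<^sub>R e)"
      by (simp only: norm_triangle_ineq4)
    also have "\<dots> \<le> norm (y - z) + norm (y - z)" using ab[of "y - z"] e by simp
    finally show ?thesis by (simp add: dist_norm)
  qed
  obtain \<delta> where \<delta>: "\<delta> > 0" "ball x \<delta> \<subseteq> closure \<Omega>"
    using x(1) unfolding mem_interior by blast
  define t where "t = min \<delta> \<rho> / 2"
  have t: "t > 0" "t < \<delta>" "t \<le> \<rho> / 2" using \<delta>(1) e(2) by (auto simp: t_def)
  define y where "y = x + t *\<^sub>R e"
  have dxy: "dist x y = t" using t e by (simp add: y_def dist_norm)
  have "x \<notin> {y \<in> ball x \<rho>. y \<bullet> e < \<psi> (y - (y \<bullet> e) *\<^sub>R e)}" using x(2) \<Omega> by blast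
  then have above: "\<psi> (P x) \<le> x \<bullet> e" using e(2) by (simp add: P_def not_less)
  have Py: "P y = P x" "y \<bullet> e = x \<bullet> e + t"
    by (auto simp: P_def y_def inner_add_left ee algebra_simps)
  \<comment> \<open>A point this close to \<open>y\<close> stays above the graph: its height drops by at most \<open>\<epsilon>\<close>, and the graph rises by at most \<open>2 * L * \<epsilon>\<close>.\<close>
  define \<epsilon> where "\<epsilon> = min (t / (1 + 2 * L)) (\<rho> / 2)"
  have \<epsilon>: "\<epsilon> > 0" "\<epsilon> \<le> \<rho> / 2" "\<epsilon> * (1 + 2 * L) \<le> t"
  proof -
    have "\<epsilon> * (1 + 2 * L) \<le> t / (1 + 2 * L) * (1 + 2 * L)"
      using L0 by (intro mult_right_mono) (auto simp: \<epsilon>_def)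
    then show "\<epsilon> * (1 + 2 * L) \<le> t" using L0 by simp
    show "\<epsilon> \<le> \<rho> / 2" unfolding \<epsilon>_def by (rule min.cobounded2)
  qed (use t L0 e in \<open>auto simp: \<epsilon>_def\<close>)
  have "y \<in> closure \<Omega>" using \<delta>(2) dxy t by auto
  then obtain z where z: "z \<in> \<Omega>" "dist z y < \<epsilon>"
    using \<epsilon>(1) unfolding closure_approachable by blast
  have "dist x z < \<rho>"
    using dist_triangle[of x z y] dxy t(3) z(2) \<epsilon>(2) by (simp add: dist_commute)
  with z(1) have "z \<in> \<Omega> \<inter> ball x \<rho>" by simp
  then have "z \<bullet> e < \<psi> (P z)" unfolding \<Omega> P_def by blast
  moreover have "\<psi> (P z) \<le> \<psi> (P y) + L * (2 * dist z y)"
  proof -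
    have "dist (\<psi> (P z)) (\<psi> (P y)) \<le> L * dist (P z) (P y)"
      by (rule lipschitz_onD[OF lip Pker Pker])
    also have "\<dots> \<le> L * (2 * dist z y)" by (intro mult_left_mono Plip L0)
    finally show ?thesis by (simp add: dist_real_def)
  qed
  moreover have "y \<bullet> e - dist z y \<le> z \<bullet> e"
    using ab[of "z - y"] by (simp add: dist_norm inner_diff_left)
  ultimately have "t < dist z y * (1 + 2 * L)"
    using above Py by (simp add: algebra_simps)
  also have "\<dots> \<le> \<epsilon> * (1 + 2 * L)" using z(2) L0 by (intro mult_right_mono) auto
  finally show False using \<epsilon>(3) by simp
qed

lemma mesh_size_cbox:
  fixes a b :: "real^'n::finite"
  assumes "box a b \<noteq> {}"
  shows "mesh_size (cbox a b) i = b $ i - a $ i"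
proof -
  have "cbox a b \<noteq> {}" using assms box_subset_cbox by blast
  then show ?thesis
    using interval_upperbound[of a b] interval_lowerbound[of a b] by (simp add: mesh_size_def box_ne_empty)
qed

text \<open>The norm on the closed element equals the integral over the open box, because the boundary is a null
set; the two outer powers cancel as the integral is non-negative.\<close>

lemma Lp_norm_cbox_powr:
  assumes "1 \<le> p"
  shows "Lp_norm p (cbox a b) f powr p = (LINT x:box a b|lebesgue. \<bar>f x\<bar> powr p)"
proof -
  have "0 \<le> (LINT x:cbox a b|lebesgue. \<bar>f x\<bar> powr p)"
    unfolding set_lebesgue_integral_def by (intro Bochner_Integration.integral_nonneg) simp
  then show ?thesis
    using assms by (simp add: Lp_norm_def powr_powr set_lebesgue_integral_cbox_box)
qed

text \<open>The representative picked by \<^const>\<open>weak_deriv\<close> need not be the one in \<open>L\<^sup>p\<close> provided by membership in the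
Sobolev space, but uniqueness makes them agree almost everywhere.\<close>

lemma Sobolev_weak_deriv_Lp:
  assumes "open \<Omega>" "u \<in> Sobolev k p \<Omega>" "\<gamma> \<in> Ind k"
  shows "has_weak_deriv \<Omega> \<gamma> u (weak_deriv \<Omega> \<gamma> u)" "weak_deriv \<Omega> \<gamma> u \<in> Lp_space p \<Omega>"
proof -
  obtain g where g: "g \<in> Lp_space p \<Omega>" "has_weak_deriv \<Omega> \<gamma> u g"
    using assms by (auto simp: Sobolev_def)
  show w: "has_weak_deriv \<Omega> \<gamma> u (weak_deriv \<Omega> \<gamma> u)" by (rule has_weak_deriv_weak_deriv[OF g(2)])
  show "weak_deriv \<Omega> \<gamma> u \<in> Lp_space p \<Omega>"
    by (rule Lp_space_cong_AE[OF g(1) has_weak_deriv_unique[OF assms(1) g(2) w]])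
qed

theorem theorem3p1:
  fixes \<Omega> :: "(real^'n::finite) set" and r :: nat and p :: real
    and Ind_used :: "('n \<Rightarrow> nat) set"
  assumes "bounded_polytopic_lipschitz_domain \<Omega>"
    and "1 \<le> r" and "1 \<le> p"
    and "finite Ind_used" and "Ind (r - 1) \<subseteq> Ind_used" and "\<not> Ind r \<subseteq> Ind_used"
  shows "\<forall>\<alpha> :: 'n \<Rightarrow> nat. mi_abs \<alpha> \<le> r + 1 \<longrightarrow>
    (\<exists>C>0. \<forall>T u. tensor_product_mesh \<Omega> T \<and> u \<in> Sobolev (r + 1) p \<Omega> \<longrightarrow>
       (INF v\<in>Vh T Ind_used. broken_norm T p \<alpha> (\<lambda>x. u x - v x))
         \<le> C * ((\<Sum>K\<in>T. \<Sum>\<gamma>\<in>Ind r - Ind_used.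
                   mesh_weight p K \<gamma> \<alpha> * Lp_norm p K (weak_deriv \<Omega> \<gamma> u) powr p)
              + (\<Sum>K\<in>T. \<Sum>\<gamma> | mi_abs \<gamma> = r + 1.
                   mesh_weight p K \<gamma> \<alpha> * Lp_norm p K (weak_deriv \<Omega> \<gamma> u) powr p)) powr (1 / p))"
proof (intro allI impI)
  fix \<alpha> :: "'n \<Rightarrow> nat" assume \<alpha>: "mi_abs \<alpha> \<le> r + 1"
  define M :: real where "M = 1 + 2 ^ CARD('n) * real CARD('n) powr p * real CARD('n)"
  \<comment> \<open>Used monomials of degree above \<open>r\<close> are left out: their derivatives of order \<open>r + 1\<close> need not vanish.\<close>
  define J where "J = Ind_used \<inter> Ind r"
  define \<Gamma> where "\<Gamma> = Ind (Suc r) - J"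
  have M: "0 < M" by (simp add: M_def add_pos_nonneg)
  have \<Gamma>_split: "\<Gamma> = (Ind r - Ind_used) \<union> {\<gamma>. mi_abs \<gamma> = r + 1}"
    by (auto simp: \<Gamma>_def J_def Ind_def)
  have top: "{\<gamma> :: 'n \<Rightarrow> nat. mi_abs \<gamma> = r + 1} \<subseteq> Ind (r + 1)" by (auto simp: Ind_def)
  have \<Omega>: "open \<Omega>" "interior (closure \<Omega>) \<subseteq> \<Omega>"
    using assms(1) lipschitz_boundary_interior_closure[of \<Omega>]
    by (auto simp: bounded_polytopic_lipschitz_domain_def)
  show "\<exists>C>0. \<forall>T u. tensor_product_mesh \<Omega> T \<and> u \<in> Sobolev (r + 1) p \<Omega> \<longrightarrow>
       (INF v\<in>Vh T Ind_used. broken_norm T p \<alpha> (\<lambda>x. u x - v x))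
         \<le> C * ((\<Sum>K\<in>T. \<Sum>\<gamma>\<in>Ind r - Ind_used.
                   mesh_weight p K \<gamma> \<alpha> * Lp_norm p K (weak_deriv \<Omega> \<gamma> u) powr p)
              + (\<Sum>K\<in>T. \<Sum>\<gamma> | mi_abs \<gamma> = r + 1.
                   mesh_weight p K \<gamma> \<alpha> * Lp_norm p K (weak_deriv \<Omega> \<gamma> u) powr p)) powr (1 / p)"
  proof (intro exI[of _ "(M ^ Suc r) powr (1 / p)"] conjI allI impI)
    show "0 < (M ^ Suc r) powr (1 / p)" using M by simp
    fix T and u :: "real^'n \<Rightarrow> real"
    assume "tensor_product_mesh \<Omega> T \<and> u \<in> Sobolev (r + 1) p \<Omega>"
    then have T: "tensor_product_mesh \<Omega> T" and u: "u \<in> Sobolev (r + 1) p \<Omega>" by auto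
    define D where "D \<gamma> = weak_deriv \<Omega> \<gamma> u" for \<gamma>
    have finT: "finite T" and cover: "\<Union>T = closure \<Omega>"
      and boxT: "\<And>K. K \<in> T \<Longrightarrow> interior K \<noteq> {} \<and> (\<exists>a b. K = cbox a b)"
      and disjT: "\<And>K K'. K \<in> T \<Longrightarrow> K' \<in> T \<Longrightarrow> K \<noteq> K' \<Longrightarrow> interior K \<inter> interior K' = {}"
      using T by (auto simp: tensor_product_mesh_def face_to_face_partition_def)
    define B where "B K = (\<Sum>\<gamma>\<in>\<Gamma>. mesh_weight p K \<gamma> \<alpha> * Lp_norm p K (D \<gamma>) powr p)" for K
    have intK: "interior K \<subseteq> \<Omega>" if "K \<in> T" for K
      using interior_mono[of K "closure \<Omega>"] cover that \<Omega>(2) by blast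
    define good where "good K q \<longleftrightarrow> q \<in> poly_space Ind_used \<and> (\<forall>v. (\<forall>x\<in>interior K. v x = q x) \<longrightarrow>
        (LINT x:K|lebesgue. \<bar>weak_deriv (interior K) \<alpha> (\<lambda>x. u x - v x) x\<bar> powr p) \<le> M ^ Suc r * B K)" for K q
    have "\<exists>q. good K q"
      if K: "K \<in> T" for K
    proof -
      obtain a b where Kab: "K = cbox a b" using boxT[OF K] by blast
      then have ne: "box a b \<noteq> {}" using boxT[OF K] by simp
      have sub: "box a b \<subseteq> \<Omega>" using intK[OF K] Kab by simp
      have "\<exists>c. \<forall>\<alpha>\<in>Ind (Suc r).
        (LINT x:box a b|lebesgue. \<bar>D \<alpha> x - multi_partial \<alpha> (\<lambda>x. \<Sum>\<beta>\<in>J. c \<beta> * vec_monomial \<beta> x) x\<bar> powr p)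
        \<le> M ^ Suc r * (\<Sum>\<gamma>\<in>\<Gamma>. (\<Prod>i\<in>UNIV. (b $ i - a $ i) powr (p * (real (\<gamma> i) - real (\<alpha> i)))) *
             (LINT x:box a b|lebesgue. \<bar>D \<gamma> x\<bar> powr p))"
        unfolding M_def
      proof (rule element_estimate[OF assms(3) ne])
        fix \<gamma> :: "'n \<Rightarrow> nat" assume "\<gamma> \<in> Ind (Suc r)"
        then have g: "\<gamma> \<in> Ind (r + 1)" by simp
        show "has_weak_deriv (box a b) \<gamma> u (D \<gamma>)"
          unfolding D_def by (rule has_weak_deriv_subset[OF Sobolev_weak_deriv_Lp(1)[OF \<Omega>(1) u g] sub])
        show "D \<gamma> \<in> Lp_space p (box a b)"
          unfolding D_def by (rule Lp_space_subset[OF Sobolev_weak_deriv_Lp(2)[OF \<Omega>(1) u g] sub]) simp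
      next
        fix \<gamma> assume "\<gamma> \<in> \<Gamma>"
        \<comment> \<open>All multi-indices of smaller order are used, so they cannot occur in \<open>\<Gamma>\<close>.\<close>
        then have "\<gamma> \<notin> Ind (r - 1)" using assms(5) by (auto simp: \<Gamma>_split Ind_def)
        then show "r \<le> mi_abs \<gamma>" by (simp add: Ind_def)
      qed (auto simp: J_def \<Gamma>_def)
      then obtain c where c: "(LINT x:box a b|lebesgue. \<bar>D \<alpha> x - multi_partial \<alpha> (\<lambda>x. \<Sum>\<beta>\<in>J. c \<beta> * vec_monomial \<beta> x) x\<bar> powr p)
        \<le> M ^ Suc r * (\<Sum>\<gamma>\<in>\<Gamma>. (\<Prod>i\<in>UNIV. (b $ i - a $ i) powr (p * (real (\<gamma> i) - real (\<alpha> i)))) *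
             (LINT x:box a b|lebesgue. \<bar>D \<gamma> x\<bar> powr p))"
        using \<alpha> by (auto simp: Ind_def)
      define q where "q = (\<lambda>x::real^'n. \<Sum>\<beta>\<in>J. c \<beta> * vec_monomial \<beta> x)"
      have q_eq: "q x = (\<Sum>\<beta>\<in>Ind_used. (if \<beta> \<in> J then c \<beta> else 0) * vec_monomial \<beta> x)" for x
        unfolding q_def using assms(4) by (intro sum.mono_neutral_cong_left) (auto simp: J_def)
      have qp: "q \<in> poly_space Ind_used"
        unfolding poly_space_def
        by (intro CollectI exI[of _ "\<lambda>\<beta>. if \<beta> \<in> J then c \<beta> else 0"] allI)
           (rule q_eq[unfolded vec_monomial_def])
      have sq: "smooth q" unfolding q_def by (intro smooth_sum smooth_scale smooth_vec_monomial)
      have bound: "(LINT x:K|lebesgue. \<bar>weak_deriv (interior K) \<alpha> (\<lambda>x. u x - v x) x\<bar> powr p) \<le> M ^ Suc r * B K"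
        if v: "\<forall>x\<in>interior K. v x = q x" for v
      proof -
        have "\<alpha> \<in> Ind (r + 1)" using \<alpha> by (simp add: Ind_def)
        then have "has_weak_deriv (box a b) \<alpha> u (D \<alpha>)"
          unfolding D_def by (intro has_weak_deriv_subset[OF Sobolev_weak_deriv_Lp(1)[OF \<Omega>(1) u] sub])
        from has_weak_deriv_diff[OF this has_weak_deriv_smooth[OF sq]]
        have d: "has_weak_deriv (box a b) \<alpha> (\<lambda>x. u x - v x) (\<lambda>x. D \<alpha> x - multi_partial \<alpha> q x)"
          by (subst has_weak_deriv_cong[where u' = "\<lambda>x. u x - q x"]) (use v Kab in auto)
        have ae: "AE x in lebesgue. x \<in> box a b \<longrightarrow>
            weak_deriv (box a b) \<alpha> (\<lambda>x. u x - v x) x = D \<alpha> x - multi_partial \<alpha> q x"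
          by (rule has_weak_deriv_unique[OF open_box has_weak_deriv_weak_deriv[OF d] d])
        have "(LINT x:box a b|lebesgue. \<bar>weak_deriv (box a b) \<alpha> (\<lambda>x. u x - v x) x\<bar> powr p)
            = (LINT x:box a b|lebesgue. \<bar>D \<alpha> x - multi_partial \<alpha> q x\<bar> powr p)"
          by (rule set_lebesgue_integral_cong_AE_on) (use ae in \<open>eventually_elim, simp\<close>)
        with c show ?thesis
          by (simp add: Kab B_def mesh_weight_def mesh_size_cbox[OF ne] Lp_norm_cbox_powr[OF assms(3)]
              set_lebesgue_integral_cbox_box q_def)
      qed
      from qp bound show ?thesis unfolding good_def by blast
    qed
    then obtain q where good: "\<And>K. K \<in> T \<Longrightarrow> good K (q K)" by metis
    \<comment> \<open>The interiors are disjoint, so the choice is unique wherever \<open>v\<close> is prescribed.\<close>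
    define v where "v x = q (SOME K. K \<in> T \<and> x \<in> interior K) x" for x
    have v: "v x = q K x" if "K \<in> T" "x \<in> interior K" for K x
    proof -
      have "(SOME K. K \<in> T \<and> x \<in> interior K) = K"
        by (rule some_equality) (use that disjT in blast)+
      then show ?thesis by (simp add: v_def)
    qed
    have vV: "v \<in> Vh T Ind_used" unfolding Vh_def using good v by (auto simp: good_def)
    have N0: "0 \<le> (LINT x:K|lebesgue. \<bar>f x\<bar> powr p)" for K and f :: "real^'n \<Rightarrow> real"
      unfolding set_lebesgue_integral_def by (intro Bochner_Integration.integral_nonneg) simp
    have "(INF v\<in>Vh T Ind_used. broken_norm T p \<alpha> (\<lambda>x. u x - v x)) \<le> broken_norm T p \<alpha> (\<lambda>x. u x - v x)"
      by (rule cINF_lower[OF _ vV]) (auto simp: broken_norm_def intro!: bdd_belowI[of _ 0])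
    also have "\<dots> \<le> (\<Sum>K\<in>T. M ^ Suc r * B K) powr (1 / p)"
      unfolding broken_norm_def
      by (intro powr_mono2 sum_mono sum_nonneg N0) (use assms(3) good v in \<open>auto simp: good_def\<close>)
    also have "(\<Sum>K\<in>T. M ^ Suc r * B K) = M ^ Suc r * (\<Sum>K\<in>T. B K)"
      by (rule sum_distrib_left[symmetric])
    also have "(M ^ Suc r * (\<Sum>K\<in>T. B K)) powr (1 / p) = (M ^ Suc r) powr (1 / p) * (\<Sum>K\<in>T. B K) powr (1 / p)"
      using M by (intro powr_mult) 
    also have "(\<Sum>K\<in>T. B K) = (\<Sum>K\<in>T. \<Sum>\<gamma>\<in>Ind r - Ind_used. mesh_weight p K \<gamma> \<alpha> * Lp_norm p K (D \<gamma>) powr p)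
        + (\<Sum>K\<in>T. \<Sum>\<gamma> | mi_abs \<gamma> = r + 1. mesh_weight p K \<gamma> \<alpha> * Lp_norm p K (D \<gamma>) powr p)"
      unfolding B_def \<Gamma>_split sum.distrib[symmetric]
      using finite_Ind[of r] finite_subset[OF top finite_Ind]
      by (intro sum.cong refl sum.union_disjoint) (auto simp: Ind_def)
    finally show "(INF v\<in>Vh T Ind_used. broken_norm T p \<alpha> (\<lambda>x. u x - v x))
         \<le> (M ^ Suc r) powr (1 / p) * ((\<Sum>K\<in>T. \<Sum>\<gamma>\<in>Ind r - Ind_used.
                   mesh_weight p K \<gamma> \<alpha> * Lp_norm p K (weak_deriv \<Omega> \<gamma> u) powr p)
              + (\<Sum>K\<in>T. \<Sum>\<gamma> | mi_abs \<gamma> = r + 1.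
                   mesh_weight p K \<gamma> \<alpha> * Lp_norm p K (weak_deriv \<Omega> \<gamma> u) powr p)) powr (1 / p)"
      unfolding D_def .
  qed
qed

end
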